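(* The group $F_2\times F_2$ (the direct product of two free groups of rank $2$) has asymptotic cones with isometrically embedded circles that are homotopically trivial. That is, there exist a finite generating set $A$ of $F_2\times F_2$, a non-principal ultrafilter on $\mathbb{N}$ and a scaling sequence such that the corresponding asymptotic cone $\mathcal{C}$ of $F_2\times F_2$ with its word metric with respect to $A$ admits a distance-preserving map $S\to\mathcal{C}$, from a circle $S$ of positive circumference with its intrinsic (arc-length) metric, which is null-homotopic in $\mathcal{C}$.
   Context: Let $G$ be a group with finite generating set $A$ and word metric $d_A$, let $\omega$ be a non-principal ultrafilter on $\mathbb{N}$, and let $(s_n)$ be a scaling sequence, i.e. a sequence of positive real numbers with $s_n\to\infty$. The asymptotic cone of $G$ with respect to $A$, $\omega$ and $(s_n)$ is the ultralimit along $\omega$ of the pointed metric spaces $(G,\tfrac{1}{s_n}d_A,1)$: its points are equivalence classes of sequences $(g_n)$ in $G$ with $d_A(1,g_n)/s_n$ bounded, with distance $d((g_n),(h_n))=\lim_\omega d_A(g_n,h_n)/s_n$, where sequences at distance $0$ are identified. (Using the Cayley graph $\mathrm{Cay}(G,A)$ in place of $(G,d_A)$ gives the same space.) *)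

theory Defs
  imports "HOL-Analysis.Analysis" "HOL-Algebra.Generated_Groups"
begin

section \<open>Free groups\<close>

text \<open>The letter \<open>(x, True)\<close> stands for the generator \<open>x\<close> and \<open>(x, False)\<close> for its inverse.
  Elements are the reduced words; \<open>cons_reduce a w\<close> is the reduced form of \<open>a # w\<close> for reduced
  \<open>w\<close>, so the product of two reduced words is the reduced form of their concatenation.\<close>

definition flip :: "'x \<times> bool \<Rightarrow> 'x \<times> bool"
  where "flip a = (fst a, \<not> snd a)"

definition reduced_word :: "('x \<times> bool) list \<Rightarrow> bool"
  where "reduced_word w \<longleftrightarrow> successively (\<lambda>a b. b \<noteq> flip a) w"

definition cons_reduce :: "'x \<times> bool \<Rightarrow> ('x \<times> bool) list \<Rightarrow> ('x \<times> bool) list"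
  where "cons_reduce a w =
    (case w of [] \<Rightarrow> [a] | b # v \<Rightarrow> if b = flip a then v else a # w)"

definition free_group :: "'x set \<Rightarrow> ('x \<times> bool) list monoid"
  where "free_group X =
    \<lparr>carrier = {w. reduced_word w \<and> fst ` set w \<subseteq> X}, mult = foldr cons_reduce, one = []\<rparr>"

definition F2 :: "(nat \<times> bool) list monoid"
  where "F2 = free_group {0, 1}"

lemma flip_flip [simp]: "flip (flip a) = a"
  by (simp add: flip_def)

lemma fst_flip [simp]: "fst (flip a) = fst a"
  by (simp add: flip_def)

lemma flip_neq [simp]: "flip a \<noteq> a" "a \<noteq> flip a"
  by (auto simp: flip_def prod_eq_iff)

lemma reduced_Nil [simp]: "reduced_word []"
  by (simp add: reduced_word_def)

lemma reduced_Cons: "reduced_word (a # w) \<longleftrightarrow> reduced_word w \<and> (w = [] \<or> hd w \<noteq> flip a)"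
  by (auto simp: reduced_word_def successively_Cons)

lemma reduced_cons_reduce: "reduced_word w \<Longrightarrow> reduced_word (cons_reduce a w)"
  by (auto simp: cons_reduce_def reduced_Cons split: list.splits)

lemma cons_reduce_flip: "reduced_word w \<Longrightarrow> cons_reduce a (cons_reduce (flip a) w) = w"
  by (auto simp: cons_reduce_def reduced_Cons split: list.splits)

lemma cons_reduce_eq_Cons: "reduced_word (a # w) \<Longrightarrow> cons_reduce a w = a # w"
  by (auto simp: cons_reduce_def reduced_Cons split: list.splits)

lemma reduced_mult: "reduced_word v \<Longrightarrow> reduced_word (foldr cons_reduce u v)"
  by (induction u) (auto intro: reduced_cons_reduce)

lemma mult_Nil_right: "reduced_word u \<Longrightarrow> foldr cons_reduce u [] = u"
  by (induction u) (auto simp: cons_reduce_eq_Cons reduced_Cons)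

lemma letters_mult: "fst ` set (foldr cons_reduce u v) \<subseteq> fst ` set u \<union> fst ` set v"
proof (induction u)
  case (Cons a u)
  have "fst ` set (cons_reduce a w) \<subseteq> insert (fst a) (fst ` set w)" for w
    by (auto simp: cons_reduce_def split: list.splits)
  from this[of "foldr cons_reduce u v"] Cons.IH show ?case by simp blast
qed simp

lemma mult_cons_reduce:
  assumes "reduced_word w"
  shows "foldr cons_reduce (cons_reduce a v) w = cons_reduce a (foldr cons_reduce v w)"
proof (cases "\<exists>v'. v = flip a # v'")
  case True
  then obtain v' where "v = flip a # v'" by blast
  then show ?thesis
    using cons_reduce_flip[OF reduced_mult[OF assms], of a v'] by (simp add: cons_reduce_def)
next
  case False
  then have "cons_reduce a v = a # v" by (auto simp: cons_reduce_def split: list.splits)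
  then show ?thesis by simp
qed

lemma mult_assoc_reduced:
  "reduced_word w \<Longrightarrow> foldr cons_reduce (foldr cons_reduce u v) w =
     foldr cons_reduce u (foldr cons_reduce v w)"
  by (induction u) (auto simp: mult_cons_reduce)

lemma mult_inverse:
  "reduced_word w \<Longrightarrow> foldr cons_reduce (rev (map flip u)) (foldr cons_reduce u w) = w"
proof (induction u)
  case (Cons a u)
  then show ?case
    using cons_reduce_flip[of "foldr cons_reduce u w" "flip a"] by (simp add: reduced_mult)
qed simp

lemma reduced_inverse: "reduced_word u \<Longrightarrow> reduced_word (rev (map flip u))"
  by (induction u)
     (auto simp: reduced_word_def successively_append_iff successively_Cons last_rev hd_map)

lemma group_free_group: "group (free_group X)"
proof (rule groupI)
  fix u v w :: "('a \<times> bool) list"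
  assume u: "u \<in> carrier (free_group X)"
  show "\<one>\<^bsub>free_group X\<^esub> \<otimes>\<^bsub>free_group X\<^esub> u = u"
    by (simp add: free_group_def)
  show "\<exists>y\<in>carrier (free_group X). y \<otimes>\<^bsub>free_group X\<^esub> u = \<one>\<^bsub>free_group X\<^esub>"
    using u mult_inverse[of "[]" u]
    by (intro bexI[of _ "rev (map flip u)"])
       (auto simp: free_group_def mult_Nil_right reduced_inverse)
  assume v: "v \<in> carrier (free_group X)"
  show "u \<otimes>\<^bsub>free_group X\<^esub> v \<in> carrier (free_group X)"
    using u v subset_trans[OF letters_mult[of u v], of X] by (simp add: free_group_def reduced_mult)
  assume "w \<in> carrier (free_group X)"
  then show "u \<otimes>\<^bsub>free_group X\<^esub> v \<otimes>\<^bsub>free_group X\<^esub> w =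
      u \<otimes>\<^bsub>free_group X\<^esub> (v \<otimes>\<^bsub>free_group X\<^esub> w)"
    by (simp add: free_group_def mult_assoc_reduced)
qed (simp add: free_group_def)


section \<open>Word metrics\<close>

definition finite_generating_set :: "('a, 'b) monoid_scheme \<Rightarrow> 'a set \<Rightarrow> bool"
  where "finite_generating_set G A \<longleftrightarrow>
    finite A \<and> A \<subseteq> carrier G \<and> generate G A = carrier G"

definition spells :: "('a, 'b) monoid_scheme \<Rightarrow> 'a set \<Rightarrow> 'a list \<Rightarrow> 'a \<Rightarrow> bool"
  where "spells G A ws g \<longleftrightarrow>
    set ws \<subseteq> A \<union> m_inv G ` A \<and> foldr (mult G) ws \<one>\<^bsub>G\<^esub> = g"

definition word_length :: "('a, 'b) monoid_scheme \<Rightarrow> 'a set \<Rightarrow> 'a \<Rightarrow> nat"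
  where "word_length G A g = (LEAST n. \<exists>ws. length ws = n \<and> spells G A ws g)"

definition word_dist :: "('a, 'b) monoid_scheme \<Rightarrow> 'a set \<Rightarrow> 'a \<Rightarrow> 'a \<Rightarrow> real"
  where "word_dist G A g h = real (word_length G A (inv\<^bsub>G\<^esub> g \<otimes>\<^bsub>G\<^esub> h))"

context group
begin

lemma spells_closed:
  assumes "A \<subseteq> carrier G" "spells G A ws g"
  shows "g \<in> carrier G"
proof -
  have "set ws \<subseteq> carrier G" using assms by (auto simp: spells_def)
  then have "foldr (\<otimes>) ws \<one> \<in> carrier G" by (induction ws) auto
  with assms show ?thesis by (simp add: spells_def)
qed

lemma spells_append:
  assumes "A \<subseteq> carrier G" "spells G A us g" "spells G A vs h"
  shows "spells G A (us @ vs) (g \<otimes> h)"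
proof -
  have h: "h \<in> carrier G" using assms spells_closed by blast
  have "foldr (\<otimes>) us k = foldr (\<otimes>) us \<one> \<otimes> k \<and> foldr (\<otimes>) us \<one> \<in> carrier G"
    if "set us \<subseteq> carrier G" "k \<in> carrier G" for us k
    using that by (induction us) (auto simp: m_assoc)
  moreover have "A \<union> m_inv G ` A \<subseteq> carrier G" using assms(1) by auto
  then have "set us \<subseteq> carrier G" using assms(2) unfolding spells_def by blast
  ultimately have "foldr (\<otimes>) us h = g \<otimes> h" using assms(2) h unfolding spells_def by blast
  with assms(2,3) show ?thesis by (simp add: spells_def)
qed

lemma spells_single:
  assumes "A \<subseteq> carrier G" "a \<in> A \<union> m_inv G ` A"
  shows "spells G A [a] a"
  using assms by (auto simp: spells_def)

lemma spells_inv: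
  assumes "A \<subseteq> carrier G" "spells G A ws g"
  shows "\<exists>vs. length vs = length ws \<and> spells G A vs (inv g)"
  using assms(2)
proof (induction ws arbitrary: g)
  case Nil
  then show ?case by (auto simp: spells_def)
next
  case (Cons a ws)
  let ?h = "foldr (\<otimes>) ws \<one>"
  have h: "spells G A ws ?h" and a: "a \<in> A \<union> m_inv G ` A" and g: "g = a \<otimes> ?h"
    using Cons.prems by (auto simp: spells_def)
  obtain vs where vs: "length vs = length ws" "spells G A vs (inv ?h)"
    using Cons.IH[OF h] by blast
  have "a \<in> carrier G" "inv a \<in> A \<union> m_inv G ` A" using a assms(1) by auto
  then have "spells G A (vs @ [inv a]) (inv g)"
    using spells_append[OF assms(1) vs(2) spells_single[OF assms(1)]]
      g spells_closed[OF assms(1) h] by (simp add: inv_mult_group)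
  with vs(1) show ?case by (intro exI[of _ "vs @ [inv a]"]) simp
qed

lemma spells_ex:
  assumes "finite_generating_set G A" "g \<in> carrier G"
  shows "\<exists>ws. spells G A ws g"
proof -
  have A: "A \<subseteq> carrier G" and "g \<in> generate G A"
    using assms by (auto simp: finite_generating_set_def)
  from this(2) show ?thesis
  proof induction
    case one
    show ?case by (rule exI[of _ "[]"]) (simp add: spells_def)
  next
    case (eng g h)
    then show ?case using spells_append[OF A] by blast
  qed (use spells_single[OF A] in blast)+
qed

lemma word_length_spells:
  assumes "finite_generating_set G A" "g \<in> carrier G"
  obtains ws where "length ws = word_length G A g" "spells G A ws g"
proof -
  have "\<exists>n ws. length ws = n \<and> spells G A ws g" using spells_ex[OF assms] by blast
  from LeastI_ex[OF this] that show ?thesis unfolding word_length_def by blast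
qed

lemma word_length_le: "spells G A ws g \<Longrightarrow> word_length G A g \<le> length ws"
  unfolding word_length_def by (rule Least_le) blast

lemma word_length_inv:
  assumes "finite_generating_set G A" "g \<in> carrier G"
  shows "word_length G A (inv g) = word_length G A g"
proof -
  have A: "A \<subseteq> carrier G" using assms by (simp add: finite_generating_set_def)
  have *: "word_length G A (inv k) \<le> word_length G A k" if k: "k \<in> carrier G" for k
  proof -
    obtain ws where ws: "length ws = word_length G A k" "spells G A ws k"
      using word_length_spells[OF assms(1) k] .
    obtain vs where "length vs = length ws" "spells G A vs (inv k)"
      using spells_inv[OF A ws(2)] by blast
    then show ?thesis using word_length_le ws(1) by metis
  qed
  from *[OF assms(2)] *[of "inv g"] assms(2) show ?thesis by simp
qed

lemma word_dist_commute:
  assumes "finite_generating_set G A" "g \<in> carrier G" "h \<in> carrier G"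
  shows "word_dist G A g h = word_dist G A h g"
  using word_length_inv[OF assms(1), of "inv g \<otimes> h"] assms(2,3)
  by (simp add: word_dist_def inv_mult_group)

lemma word_dist_eq_0_iff:
  assumes "finite_generating_set G A" "g \<in> carrier G" "h \<in> carrier G"
  shows "word_dist G A g h = 0 \<longleftrightarrow> g = h"
proof
  assume "word_dist G A g h = 0"
  then have "word_length G A (inv g \<otimes> h) = 0" by (simp add: word_dist_def)
  moreover obtain ws where "length ws = word_length G A (inv g \<otimes> h)"
      "spells G A ws (inv g \<otimes> h)"
    using word_length_spells[OF assms(1), of "inv g \<otimes> h"] assms by auto
  ultimately have "inv g \<otimes> h = \<one>" by (simp add: spells_def)
  then show "g = h" using assms by (metis inv_closed inv_equality inv_inv)
next
  assume "g = h"
  then show "word_dist G A g h = 0"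
    using word_length_le[of A "[]" \<one>] assms by (simp add: word_dist_def spells_def)
qed

lemma word_dist_triangle:
  assumes "finite_generating_set G A"
    and c: "g \<in> carrier G" "h \<in> carrier G" "k \<in> carrier G"
  shows "word_dist G A g k \<le> word_dist G A g h + word_dist G A h k"
proof -
  have A: "A \<subseteq> carrier G" using assms by (simp add: finite_generating_set_def)
  obtain us where us: "length us = word_length G A (inv g \<otimes> h)" "spells G A us (inv g \<otimes> h)"
    using word_length_spells[OF assms(1), of "inv g \<otimes> h"] c by auto
  obtain vs where vs: "length vs = word_length G A (inv h \<otimes> k)" "spells G A vs (inv h \<otimes> k)"
    using word_length_spells[OF assms(1), of "inv h \<otimes> k"] c by auto
  have "h \<otimes> (inv h \<otimes> k) = k" using c m_assoc[of h "inv h" k] by simp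
  then have "(inv g \<otimes> h) \<otimes> (inv h \<otimes> k) = inv g \<otimes> k"
    using c by (simp add: m_assoc)
  then have "word_length G A (inv g \<otimes> k) \<le> length (us @ vs)"
    using spells_append[OF A us(2) vs(2)] word_length_le by metis
  then show ?thesis using us vs by (simp add: word_dist_def)
qed

end


section \<open>Ultralimits of pointed metric spaces\<close>

definition nonprincipal_ultrafilter :: "nat filter \<Rightarrow> bool"
  where "nonprincipal_ultrafilter \<omega> \<longleftrightarrow>
    \<omega> \<noteq> bot \<and>
    (\<forall>P. eventually P \<omega> \<or> eventually (\<lambda>n. \<not> P n) \<omega>) \<and>
    (\<forall>n. \<not> eventually (\<lambda>m. m = n) \<omega>)"

definition ultralimit_seqs ::
    "(nat \<Rightarrow> 'a set) \<Rightarrow> (nat \<Rightarrow> 'a \<Rightarrow> 'a \<Rightarrow> real) \<Rightarrow> (nat \<Rightarrow> 'a) \<Rightarrow> (nat \<Rightarrow> 'a) set"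
  where "ultralimit_seqs M d p =
    {x. (\<forall>n. x n \<in> M n) \<and> (\<exists>B. \<forall>n. d n (p n) (x n) \<le> B)}"

definition ultralimit_rel ::
    "nat filter \<Rightarrow> (nat \<Rightarrow> 'a set) \<Rightarrow> (nat \<Rightarrow> 'a \<Rightarrow> 'a \<Rightarrow> real) \<Rightarrow> (nat \<Rightarrow> 'a)
      \<Rightarrow> ((nat \<Rightarrow> 'a) \<times> (nat \<Rightarrow> 'a)) set"
  where "ultralimit_rel \<omega> M d p =
    {(x, y). x \<in> ultralimit_seqs M d p \<and> y \<in> ultralimit_seqs M d p \<and>
             ((\<lambda>n. d n (x n) (y n)) \<longlongrightarrow> 0) \<omega>}"

definition ultralimit ::
    "nat filter \<Rightarrow> (nat \<Rightarrow> 'a set) \<Rightarrow> (nat \<Rightarrow> 'a \<Rightarrow> 'a \<Rightarrow> real) \<Rightarrow> (nat \<Rightarrow> 'a)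
      \<Rightarrow> (nat \<Rightarrow> 'a) set set"
  where "ultralimit \<omega> M d p = ultralimit_seqs M d p // ultralimit_rel \<omega> M d p"

text \<open>The value \<open>0\<close> outside the ultralimit only serves the requirement of \<^locale>\<open>Metric_space\<close>
  that distances be non-negative and symmetric on the whole type.\<close>

definition ultralimit_dist ::
    "nat filter \<Rightarrow> (nat \<Rightarrow> 'a set) \<Rightarrow> (nat \<Rightarrow> 'a \<Rightarrow> 'a \<Rightarrow> real) \<Rightarrow> (nat \<Rightarrow> 'a)
      \<Rightarrow> (nat \<Rightarrow> 'a) set \<Rightarrow> (nat \<Rightarrow> 'a) set \<Rightarrow> real"
  where "ultralimit_dist \<omega> M d p X Y =
    (if X \<in> ultralimit \<omega> M d p \<and> Y \<in> ultralimit \<omega> M d p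
     then THE r. \<forall>x\<in>X. \<forall>y\<in>Y. ((\<lambda>n. d n (x n) (y n)) \<longlongrightarrow> r) \<omega>
     else 0)"

lemma ultrafilter_bounded_convergent:
  fixes f :: "nat \<Rightarrow> real"
  assumes "nonprincipal_ultrafilter \<omega>" "\<And>n. \<bar>f n\<bar> \<le> B"
  shows "\<exists>l. (f \<longlongrightarrow> l) \<omega>"
proof -
  have "filtermap f \<omega> \<noteq> bot"
    using assms(1) by (simp add: nonprincipal_ultrafilter_def filtermap_bot_iff)
  moreover have "eventually (\<lambda>x. x \<in> {-B..B}) (filtermap f \<omega>)"
    using assms(2) by (simp add: eventually_filtermap abs_le_iff minus_le_iff)
  ultimately obtain l where l: "inf (nhds l) (filtermap f \<omega>) \<noteq> bot"
    using compact_Icc[of "-B" B] unfolding compact_filter by blast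
  have "(f \<longlongrightarrow> l) \<omega>"
  proof (rule topological_tendstoI, rule ccontr)
    fix S assume S: "open S" "l \<in> S" "\<not> eventually (\<lambda>n. f n \<in> S) \<omega>"
    then have "eventually (\<lambda>y. y \<notin> S) (filtermap f \<omega>)"
      using assms(1) by (auto simp: nonprincipal_ultrafilter_def eventually_filtermap)
    moreover have "eventually (\<lambda>y. y \<in> S) (nhds l)"
      using S by (simp add: eventually_nhds_in_open)
    ultimately have "eventually (\<lambda>_. False) (inf (nhds l) (filtermap f \<omega>))"
      unfolding eventually_inf by blast
    with l show False by (simp add: trivial_limit_def)
  qed
  then show ?thesis ..
qed

context
  fixes \<omega> :: "nat filter" and M :: "nat \<Rightarrow> 'a set" and d :: "nat \<Rightarrow> 'a \<Rightarrow> 'a \<Rightarrow> real"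
    and p :: "nat \<Rightarrow> 'a"
  assumes \<omega>: "nonprincipal_ultrafilter \<omega>"
    and p: "\<And>n. p n \<in> M n"
    and nonneg: "\<And>n x y. \<lbrakk>x \<in> M n; y \<in> M n\<rbrakk> \<Longrightarrow> 0 \<le> d n x y"
    and refl: "\<And>n x. x \<in> M n \<Longrightarrow> d n x x = 0"
    and commute: "\<And>n x y. \<lbrakk>x \<in> M n; y \<in> M n\<rbrakk> \<Longrightarrow> d n x y = d n y x"
    and triangle: "\<And>n x y z. \<lbrakk>x \<in> M n; y \<in> M n; z \<in> M n\<rbrakk> \<Longrightarrow> d n x z \<le> d n x y + d n y z"
begin

lemma ultralimit_seq_mem: "x \<in> ultralimit_seqs M d p \<Longrightarrow> x n \<in> M n"
  by (simp add: ultralimit_seqs_def)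

lemma ultralimit_seqs_convergent:
  assumes "x \<in> ultralimit_seqs M d p" "y \<in> ultralimit_seqs M d p"
  shows "\<exists>r. ((\<lambda>n. d n (x n) (y n)) \<longlongrightarrow> r) \<omega>"
proof -
  obtain B C where BC: "\<And>n. d n (p n) (x n) \<le> B" "\<And>n. d n (p n) (y n) \<le> C"
    using assms by (auto simp: ultralimit_seqs_def)
  have "\<bar>d n (x n) (y n)\<bar> \<le> B + C" for n
    using BC[of n] nonneg[of "x n" n "y n"] triangle[of "x n" n "p n" "y n"]
      commute[of "x n" n "p n"] assms p[of n] by (simp add: ultralimit_seq_mem)
  then show ?thesis by (rule ultrafilter_bounded_convergent[OF \<omega>])
qed

lemma ultralimit_tendsto_triangle:
  assumes "x \<in> ultralimit_seqs M d p" "y \<in> ultralimit_seqs M d p" "z \<in> ultralimit_seqs M d p"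
    and "((\<lambda>n. d n (x n) (y n)) \<longlongrightarrow> a) \<omega>" "((\<lambda>n. d n (y n) (z n)) \<longlongrightarrow> b) \<omega>"
      "((\<lambda>n. d n (x n) (z n)) \<longlongrightarrow> c) \<omega>"
  shows "c \<le> a + b"
proof (rule tendsto_le[OF _ tendsto_add[OF assms(4,5)] assms(6)])
  show "\<omega> \<noteq> bot" using \<omega> by (simp add: nonprincipal_ultrafilter_def)
  show "eventually (\<lambda>n. d n (x n) (z n) \<le> d n (x n) (y n) + d n (y n) (z n)) \<omega>"
    using assms triangle by (intro always_eventually allI) (simp add: ultralimit_seq_mem)
qed

lemma ultralimit_tendsto_commute:
  assumes "x \<in> ultralimit_seqs M d p" "y \<in> ultralimit_seqs M d p"
    and "((\<lambda>n. d n (x n) (y n)) \<longlongrightarrow> a) \<omega>"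
  shows "((\<lambda>n. d n (y n) (x n)) \<longlongrightarrow> a) \<omega>"
  using assms commute by (simp add: ultralimit_seq_mem)

lemma ultralimit_tendsto_nonneg:
  assumes "x \<in> ultralimit_seqs M d p" "y \<in> ultralimit_seqs M d p"
    and "((\<lambda>n. d n (x n) (y n)) \<longlongrightarrow> a) \<omega>"
  shows "0 \<le> a"
proof (rule tendsto_lowerbound[OF assms(3)])
  show "\<omega> \<noteq> bot" using \<omega> by (simp add: nonprincipal_ultrafilter_def)
  show "eventually (\<lambda>n. 0 \<le> d n (x n) (y n)) \<omega>"
    using assms nonneg by (intro always_eventually allI) (simp add: ultralimit_seq_mem)
qed

lemma ultralimit_rel_equiv: "equiv (ultralimit_seqs M d p) (ultralimit_rel \<omega> M d p)"
proof (rule equivI)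
  show "refl_on (ultralimit_seqs M d p) (ultralimit_rel \<omega> M d p)"
    using refl by (auto simp: refl_on_def ultralimit_rel_def ultralimit_seq_mem)
  show "sym (ultralimit_rel \<omega> M d p)"
    using ultralimit_tendsto_commute by (auto simp: sym_def ultralimit_rel_def)
  show "trans (ultralimit_rel \<omega> M d p)"
  proof (rule transI)
    fix x y z assume *: "(x, y) \<in> ultralimit_rel \<omega> M d p" "(y, z) \<in> ultralimit_rel \<omega> M d p"
    then have mem: "x \<in> ultralimit_seqs M d p" "y \<in> ultralimit_seqs M d p"
        "z \<in> ultralimit_seqs M d p" by (auto simp: ultralimit_rel_def)
    obtain r where r: "((\<lambda>n. d n (x n) (z n)) \<longlongrightarrow> r) \<omega>"
      using ultralimit_seqs_convergent mem by blast
    have "r \<le> 0 + 0"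
      using ultralimit_tendsto_triangle[OF mem _ _ r, of 0 0] * by (simp add: ultralimit_rel_def)
    with ultralimit_tendsto_nonneg[OF mem(1,3) r] have "r = 0" by simp
    with r mem show "(x, z) \<in> ultralimit_rel \<omega> M d p" by (simp add: ultralimit_rel_def)
  qed
qed (auto simp: ultralimit_rel_def)

lemma ultralimit_dist_tendsto:
  assumes X: "X \<in> ultralimit \<omega> M d p" and Y: "Y \<in> ultralimit \<omega> M d p"
    and x: "x \<in> X" and y: "y \<in> Y"
  shows "((\<lambda>n. d n (x n) (y n)) \<longlongrightarrow> ultralimit_dist \<omega> M d p X Y) \<omega>"
proof -
  have bot: "\<omega> \<noteq> bot" using \<omega> by (simp add: nonprincipal_ultrafilter_def)
  note eq = ultralimit_rel_equiv
  have sub: "X \<subseteq> ultralimit_seqs M d p" "Y \<subseteq> ultralimit_seqs M d p"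
    using X Y in_quotient_imp_subset[OF eq] by (auto simp: ultralimit_def)
  obtain r where r: "((\<lambda>n. d n (x n) (y n)) \<longlongrightarrow> r) \<omega>"
    using ultralimit_seqs_convergent sub x y by blast
  have r': "((\<lambda>n. d n (x' n) (y' n)) \<longlongrightarrow> r) \<omega>" if x': "x' \<in> X" and y': "y' \<in> Y" for x' y'
  proof -
    have "(x, x') \<in> ultralimit_rel \<omega> M d p" "(y, y') \<in> ultralimit_rel \<omega> M d p"
      using X Y quotient_eq_iff[OF eq] x y x' y' unfolding ultralimit_def by blast+
    then have xx: "((\<lambda>n. d n (x n) (x' n)) \<longlongrightarrow> 0) \<omega>" "((\<lambda>n. d n (y n) (y' n)) \<longlongrightarrow> 0) \<omega>"
      by (auto simp: ultralimit_rel_def)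
    have m: "x \<in> ultralimit_seqs M d p" "y \<in> ultralimit_seqs M d p"
        "x' \<in> ultralimit_seqs M d p" "y' \<in> ultralimit_seqs M d p"
      using sub x y x' y' by auto
    obtain q where q: "((\<lambda>n. d n (x' n) (y' n)) \<longlongrightarrow> q) \<omega>"
      using ultralimit_seqs_convergent m by blast
    obtain t where t: "((\<lambda>n. d n (x' n) (y n)) \<longlongrightarrow> t) \<omega>"
      using ultralimit_seqs_convergent m by blast
    note sw = ultralimit_tendsto_commute[OF m(1,3) xx(1)] ultralimit_tendsto_commute[OF m(2,4) xx(2)]
    have "t \<le> 0 + r" using ultralimit_tendsto_triangle[OF m(3,1,2) sw(1) r t] .
    moreover have "r \<le> 0 + t" using ultralimit_tendsto_triangle[OF m(1,3,2) xx(1) t r] .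
    moreover have "q \<le> t + 0" using ultralimit_tendsto_triangle[OF m(3,2,4) t xx(2) q] .
    moreover have "t \<le> q + 0" using ultralimit_tendsto_triangle[OF m(3,4,2) q sw(2) t] .
    ultimately show ?thesis using q by simp
  qed
  have "(THE r. \<forall>x\<in>X. \<forall>y\<in>Y. ((\<lambda>n. d n (x n) (y n)) \<longlongrightarrow> r) \<omega>) = r"
  proof (rule the_equality)
    fix q assume "\<forall>x\<in>X. \<forall>y\<in>Y. ((\<lambda>n. d n (x n) (y n)) \<longlongrightarrow> q) \<omega>"
    then show "q = r" using tendsto_unique[OF bot] r x y by blast
  qed (use r' in blast)
  with r X Y show ?thesis by (simp add: ultralimit_dist_def)
qed

lemma Metric_space_ultralimit:
  "Metric_space (ultralimit \<omega> M d p) (ultralimit_dist \<omega> M d p)"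
proof -
  note eq = ultralimit_rel_equiv
  have bot: "\<omega> \<noteq> bot" using \<omega> by (simp add: nonprincipal_ultrafilter_def)
  have ne: "\<exists>x. x \<in> X \<and> x \<in> ultralimit_seqs M d p" if "X \<in> ultralimit \<omega> M d p" for X
    using that in_quotient_imp_non_empty[OF eq] in_quotient_imp_subset[OF eq]
    unfolding ultralimit_def by blast
  show ?thesis
  proof
    fix X Y
    show "0 \<le> ultralimit_dist \<omega> M d p X Y"
    proof (cases "X \<in> ultralimit \<omega> M d p \<and> Y \<in> ultralimit \<omega> M d p")
      case True
      with ne show ?thesis using ultralimit_dist_tendsto ultralimit_tendsto_nonneg by blast
    qed (auto simp: ultralimit_dist_def)
    show "ultralimit_dist \<omega> M d p X Y = ultralimit_dist \<omega> M d p Y X"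
    proof (cases "X \<in> ultralimit \<omega> M d p \<and> Y \<in> ultralimit \<omega> M d p")
      case True
      then obtain x y where "x \<in> X" "x \<in> ultralimit_seqs M d p" "y \<in> Y" "y \<in> ultralimit_seqs M d p"
        using ne by blast
      with True show ?thesis
        using tendsto_unique[OF bot ultralimit_dist_tendsto[of Y X y x]
          ultralimit_tendsto_commute[OF _ _ ultralimit_dist_tendsto[of X Y x y]]] by simp
    qed (auto simp: ultralimit_dist_def)
  next
    fix X Y assume XY: "X \<in> ultralimit \<omega> M d p" "Y \<in> ultralimit \<omega> M d p"
    then obtain x y where xy: "x \<in> X" "x \<in> ultralimit_seqs M d p" "y \<in> Y" "y \<in> ultralimit_seqs M d p"
      using ne by blast
    have "ultralimit_dist \<omega> M d p X Y = 0 \<longleftrightarrow> (x, y) \<in> ultralimit_rel \<omega> M d p"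
      using ultralimit_dist_tendsto[OF XY xy(1,3)] xy tendsto_unique[OF bot]
      by (auto simp: ultralimit_rel_def)
    also have "\<dots> \<longleftrightarrow> X = Y"
      using quotient_eq_iff[OF eq] XY xy unfolding ultralimit_def by blast
    finally show "ultralimit_dist \<omega> M d p X Y = 0 \<longleftrightarrow> X = Y" .
  next
    fix X Y Z
    assume *: "X \<in> ultralimit \<omega> M d p" "Y \<in> ultralimit \<omega> M d p" "Z \<in> ultralimit \<omega> M d p"
    obtain x where x: "x \<in> X" "x \<in> ultralimit_seqs M d p" using ne *(1) by blast
    obtain y where y: "y \<in> Y" "y \<in> ultralimit_seqs M d p" using ne *(2) by blast
    obtain z where z: "z \<in> Z" "z \<in> ultralimit_seqs M d p" using ne *(3) by blast
    show "ultralimit_dist \<omega> M d p X Z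
        \<le> ultralimit_dist \<omega> M d p X Y + ultralimit_dist \<omega> M d p Y Z"
      by (rule ultralimit_tendsto_triangle[OF x(2) y(2) z(2)])
         (intro ultralimit_dist_tendsto * x(1) y(1) z(1))+
  qed
qed

end


section \<open>Asymptotic cones\<close>

definition scaling_sequence :: "(nat \<Rightarrow> real) \<Rightarrow> bool"
  where "scaling_sequence s \<longleftrightarrow> (\<forall>n. 0 < s n) \<and> filterlim s at_top sequentially"

definition asymptotic_cone ::
    "('a, 'b) monoid_scheme \<Rightarrow> 'a set \<Rightarrow> nat filter \<Rightarrow> (nat \<Rightarrow> real) \<Rightarrow> (nat \<Rightarrow> 'a) set set"
  where "asymptotic_cone G A \<omega> s =
    ultralimit \<omega> (\<lambda>_. carrier G) (\<lambda>n g h. word_dist G A g h / s n) (\<lambda>_. \<one>\<^bsub>G\<^esub>)"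

definition asymptotic_cone_dist ::
    "('a, 'b) monoid_scheme \<Rightarrow> 'a set \<Rightarrow> nat filter \<Rightarrow> (nat \<Rightarrow> real)
      \<Rightarrow> (nat \<Rightarrow> 'a) set \<Rightarrow> (nat \<Rightarrow> 'a) set \<Rightarrow> real"
  where "asymptotic_cone_dist G A \<omega> s =
    ultralimit_dist \<omega> (\<lambda>_. carrier G) (\<lambda>n g h. word_dist G A g h / s n) (\<lambda>_. \<one>\<^bsub>G\<^esub>)"

lemma Metric_space_asymptotic_cone:
  assumes "group G" "finite_generating_set G A" "nonprincipal_ultrafilter \<omega>" "scaling_sequence s"
  shows "Metric_space (asymptotic_cone G A \<omega> s) (asymptotic_cone_dist G A \<omega> s)"
proof -
  interpret group G by fact
  have s: "0 < s n" for n using assms(4) by (simp add: scaling_sequence_def)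
  show ?thesis
    unfolding asymptotic_cone_def asymptotic_cone_dist_def
  proof (rule Metric_space_ultralimit[OF assms(3)])
    fix n g h k
    assume gh: "g \<in> carrier G" "h \<in> carrier G"
    show "0 \<le> word_dist G A g h / s n" using s[of n] by (simp add: word_dist_def)
    show "word_dist G A g h / s n = word_dist G A h g / s n"
      using word_dist_commute[OF assms(2) gh] by simp
    assume "k \<in> carrier G"
    then show "word_dist G A g k / s n \<le> word_dist G A g h / s n + word_dist G A h k / s n"
      using word_dist_triangle[OF assms(2) gh] s[of n]
      by (simp flip: add_divide_distrib add: divide_right_mono)
  qed (use word_dist_eq_0_iff[OF assms(2)] in auto)
qed


section \<open>Circles with the arc-length metric\<close>

text \<open>The circle of radius \<open>r\<close> in the complex plane. The principal argument lies in \<open>(-pi, pi]\<close>,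
  so \<open>\<bar>Arg (z / w)\<bar>\<close> is the angle of the shorter arc between \<open>z\<close> and \<open>w\<close>.\<close>

definition arc_dist :: "real \<Rightarrow> complex \<Rightarrow> complex \<Rightarrow> real"
  where "arc_dist r z w = r * \<bar>Arg (z / w)\<bar>"

lemma abs_Arg_times_le:
  assumes "z \<noteq> 0" "w \<noteq> 0"
  shows "\<bar>Arg (z * w)\<bar> \<le> \<bar>Arg z\<bar> + \<bar>Arg w\<bar>"
  using Arg_times'[OF assms] Arg_bounded[of z] Arg_bounded[of w]
  by (auto simp: Let_def split: if_splits)

lemma Metric_space_circle:
  assumes "0 < r"
  shows "Metric_space (sphere (0::complex) r) (arc_dist r)"
proof
  fix z w :: complex
  show "0 \<le> arc_dist r z w" using assms by (simp add: arc_dist_def)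
  show "arc_dist r z w = arc_dist r w z"
    using Arg_inverse[of "z / w"] by (auto simp: arc_dist_def split: if_splits)
next
  fix z w :: complex assume zw: "z \<in> sphere 0 r" "w \<in> sphere 0 r"
  then have nz: "z \<noteq> 0" "w \<noteq> 0" "cmod (z / w) = 1" using assms by (auto simp: norm_divide)
  have "Arg (z / w) = 0 \<longleftrightarrow> z / w = 1"
    using Arg_eq[of "z / w"] nz by auto
  then show "arc_dist r z w = 0 \<longleftrightarrow> z = w"
    using assms nz by (simp add: arc_dist_def)
next
  fix x y z :: complex assume "x \<in> sphere 0 r" "y \<in> sphere 0 r" "z \<in> sphere 0 r"
  then have nz: "x \<noteq> 0" "y \<noteq> 0" "z \<noteq> 0" using assms by auto
  have "\<bar>Arg (x / z)\<bar> \<le> \<bar>Arg (x / y)\<bar> + \<bar>Arg (y / z)\<bar>"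
    using abs_Arg_times_le[of "x / y" "y / z"] nz by simp
  then show "arc_dist r x z \<le> arc_dist r x y + arc_dist r y z"
    using assms by (simp add: arc_dist_def flip: distrib_left)
qed


section \<open>Distance-preserving and null-homotopic maps\<close>

definition isometric_embedding ::
    "'a set \<Rightarrow> ('a \<Rightarrow> 'a \<Rightarrow> real) \<Rightarrow> 'b set \<Rightarrow> ('b \<Rightarrow> 'b \<Rightarrow> real) \<Rightarrow> ('a \<Rightarrow> 'b) \<Rightarrow> bool"
  where "isometric_embedding M d M' d' f \<longleftrightarrow>
    f \<in> M \<rightarrow> M' \<and> (\<forall>x\<in>M. \<forall>y\<in>M. d' (f x) (f y) = d x y)"

definition null_homotopic :: "'a topology \<Rightarrow> 'b topology \<Rightarrow> ('a \<Rightarrow> 'b) \<Rightarrow> bool"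
  where "null_homotopic X Y f \<longleftrightarrow>
    (\<exists>c\<in>topspace Y. homotopic_with (\<lambda>_. True) X Y f (\<lambda>_. c))"

end

(* Besides the four free generators (a,1), (b,1), (1,a), (1,b), take as generators the elements
   (x^2, y^-2) with x, y in {a, b}. These fast generators move both coordinates by 2 and preserve
   the total exponent sum. In a quadrant of the flat spanned by the rays a^i and b^i in both
   factors, the exponent sum is |i| + |j|, so the square |i| + |j| = n has sides of length n / 2
   in the word metric. A path between opposite sides has to pass the identity in each coordinate;
   at these times the other coordinate has length about n, unless the path has spent slow
   generators to lower the exponent sum, and this makes the path as long as the shorter way around
   the square. Hence the square becomes an isometrically embedded circle in the cone, and it
   contracts radially inside the flat. *)
theory Submission
  imports Defs
begin

text \<open>The negative half of each line is spelled with positive powers of the second letter, not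
  with inverses of the first. So the exponent sum equals the length on both rays, and this ties it
  to the sizes of the coordinates. The exponent 2 of the fast generators makes slow detours
  unprofitable. With exponent 1, the points (a^(n/2), a^(n/2)) and (b^(n/2), b^(n/2)) would be 2n
  apart along the square, but erasing the first coordinate by slow steps, trading the second for the
  first by fast steps and rebuilding the second by slow steps would take only 3n/2. With exponent 2
  these numbers become n and 5n/4. The argument with two passages serves opposite sides. For two
  points on one side or on adjacent sides, a single coordinate difference already gives the sharp
  lower bound. Parity, rounding and passages close to the identity cost only additive constants,
  which vanish after rescaling; hence the distances in the cone are exact.\<close>

lemma DirProd_mult [simp]: "(g, h) \<otimes>\<^bsub>G \<times>\<times> H\<^esub> (g', h') = (g \<otimes>\<^bsub>G\<^esub> g', h \<otimes>\<^bsub>H\<^esub> h')"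
  by (simp add: DirProd_def)

section \<open>Shortest spellings read as paths of group elements\<close>

lemma (in group) word_length_path:
  assumes A: "finite_generating_set G A" and g: "g \<in> carrier G" and h: "h \<in> carrier G"
  obtains P where "P 0 = g" "P (word_length G A (inv g \<otimes> h)) = h"
    "\<And>k. P k \<in> carrier G"
    "\<And>k. k < word_length G A (inv g \<otimes> h) \<Longrightarrow> \<exists>c\<in>A \<union> m_inv G ` A. P (Suc k) = P k \<otimes> c"
proof -
  have sub: "A \<union> m_inv G ` A \<subseteq> carrier G"
    using A by (auto simp: finite_generating_set_def)
  have path: "\<exists>P. P 0 = g \<and> P (length ws) = g \<otimes> k \<and> (\<forall>k. P k \<in> carrier G) \<and>
      (\<forall>k<length ws. \<exists>c\<in>A \<union> m_inv G ` A. P (Suc k) = P k \<otimes> c)"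
    if "g \<in> carrier G" "spells G A ws k" for g k ws
    using that
  proof (induction ws arbitrary: g k)
    case Nil
    then show ?case by (intro exI[of _ "\<lambda>_. g"]) (auto simp: spells_def)
  next
    case (Cons a ws)
    let ?h = "foldr (\<otimes>) ws \<one>"
    have ws: "spells G A ws ?h" and a: "a \<in> A \<union> m_inv G ` A" and k: "k = a \<otimes> ?h"
      using Cons.prems by (auto simp: spells_def)
    have h: "?h \<in> carrier G"
      using spells_closed[OF _ ws] sub by blast
    have ac: "a \<in> carrier G" using a sub by blast
    obtain P where P: "P 0 = g \<otimes> a" "P (length ws) = g \<otimes> a \<otimes> ?h" "\<forall>k. P k \<in> carrier G"
      "\<forall>k<length ws. \<exists>c\<in>A \<union> m_inv G ` A. P (Suc k) = P k \<otimes> c"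
      using Cons.IH[OF _ ws, of "g \<otimes> a"] Cons.prems(1) ac by auto
    \<comment> \<open>The path for \<open>ws\<close> starts at \<open>g \<otimes> a\<close>;
      \<open>case_nat\<close> puts \<open>g\<close> in front of it.\<close>
    show ?case
      using P a ac h k Cons.prems(1)
      by (intro exI[of _ "case_nat g P"]) (auto simp: m_assoc split: nat.splits)
  qed
  have gh: "inv g \<otimes> h \<in> carrier G" using g h by simp
  obtain ws where ws: "length ws = word_length G A (inv g \<otimes> h)" "spells G A ws (inv g \<otimes> h)"
    using word_length_spells[OF A gh] .
  have "g \<otimes> (inv g \<otimes> h) = h" using g h m_assoc[of g "inv g" h] by simp
  with path[OF g ws(2)] ws(1) that show thesis by auto
qed

lemma (in group) word_dist_mult_le_1:
  assumes "A \<subseteq> carrier G" "g \<in> carrier G" "c \<in> A \<union> m_inv G ` A"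
  shows "word_dist G A g (g \<otimes> c) \<le> 1"
proof -
  have "c \<in> carrier G" using assms by auto
  then have "inv g \<otimes> (g \<otimes> c) = c" using assms(2) m_assoc[of "inv g" g c] by simp
  then show ?thesis
    using word_length_le[OF spells_single[OF assms(1,3)]] by (simp add: word_dist_def)
qed

section \<open>Reduced words\<close>

text \<open>The product recurses on its left factor, whereas the steps of a path act at the right
  end of a word.\<close>

lemma mult_letter:
  "reduced_word u \<Longrightarrow> foldr cons_reduce u [l] =
     (if u \<noteq> [] \<and> last u = flip l then butlast u else u @ [l])"
proof (induction u)
  case (Cons a u)
  show ?case
  proof (cases u)
    case Nil
    then show ?thesis by (auto simp: cons_reduce_def)
  next
    case bv: (Cons b v)
    define w where "w = foldr cons_reduce u [l]"
    have w: "w = (if last u = flip l then butlast u else u @ [l])"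
      using Cons.IH Cons.prems bv by (simp add: w_def reduced_Cons)
    have b: "b \<noteq> flip a" using Cons.prems bv by (simp add: reduced_Cons)
    have "cons_reduce a w = a # w"
      unfolding w cons_reduce_def using b bv by (cases v) auto
    then have "foldr cons_reduce (a # u) [l] = a # w" by (simp add: w_def)
    then show ?thesis using w bv by simp
  qed
qed simp

text \<open>Lets the inductions below consume the right factor one letter at a time.\<close>

lemma mult_Cons_letter:
  assumes "reduced_word (l # c)"
  shows "foldr cons_reduce u (l # c) = foldr cons_reduce (foldr cons_reduce u [l]) c"
  using assms mult_assoc_reduced[of c u "[l]"]
  by (simp add: reduced_Cons cons_reduce_eq_Cons del: foldr.simps(2)) (simp add: cons_reduce_eq_Cons reduced_Cons)

lemma length_mult_diff:
  assumes "reduced_word u" "reduced_word c"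
  shows "\<bar>real (length (foldr cons_reduce u c)) - real (length u)\<bar> \<le> length c"
  using assms
proof (induction c arbitrary: u)
  case Nil
  then show ?case by (simp add: mult_Nil_right)
next
  case (Cons l c)
  let ?v = "foldr cons_reduce u [l]"
  have v: "\<bar>real (length ?v) - real (length u)\<bar> \<le> 1"
    using mult_letter[OF Cons.prems(1), of l] by (cases u rule: rev_cases) auto
  have "\<bar>real (length (foldr cons_reduce ?v c)) - real (length ?v)\<bar> \<le> length c"
    using Cons by (intro Cons.IH reduced_mult) (auto simp: reduced_Cons)
  with v show ?case using mult_Cons_letter[OF Cons.prems(2), of u] by simp
qed

lemma hd_mult_letter:
  assumes "reduced_word u" "foldr cons_reduce u [l] \<noteq> []" "u \<noteq> []"
  shows "hd (foldr cons_reduce u [l]) = hd u"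
  using assms mult_letter[OF assms(1), of l] by (cases u; cases "tl u") (auto split: if_splits)

text \<open>At most two letters cancel, so a word of length at least 2 can lose its first letter
  only by vanishing. At length 1 this fails: a letter times its inverse square is the inverse
  letter. Hence passages near the identity are later detected by length at most 1.\<close>

lemma hd_mult_short:
  assumes "reduced_word u" "reduced_word c" "length c \<le> 2" "2 \<le> length u"
    "foldr cons_reduce u c \<noteq> []"
  shows "hd (foldr cons_reduce u c) = hd u"
proof -
  consider "c = []" | l where "c = [l]" | l l' where "c = [l, l']"
    using assms(3) by (cases c; cases "tl c"; force)
  then show ?thesis
  proof cases
    case 1
    then show ?thesis using assms by (simp add: mult_Nil_right)
  next
    case 2
    then show ?thesis using assms hd_mult_letter by fastforce
  next
    case 3
    let ?v = "foldr cons_reduce u [l]"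
    have "foldr cons_reduce u c = foldr cons_reduce ?v [l']"
      using mult_Cons_letter[of l "[l']" u] assms(2) 3 by simp
    moreover have "?v \<noteq> []"
      using length_mult_diff[OF assms(1), of "[l]"] assms(4)
      by (auto simp: reduced_Cons)
    moreover have "reduced_word ?v" by (rule reduced_mult) (simp add: reduced_Cons)
    moreover have "hd ?v = hd u"
      using assms \<open>?v \<noteq> []\<close> by (intro hd_mult_letter) auto
    ultimately show ?thesis using hd_mult_letter[of ?v l'] assms(5) by simp
  qed
qed

section \<open>The exponent sum as a homomorphism to the integers\<close>

definition exp_sum :: "('x \<times> bool) list \<Rightarrow> real"
  where "exp_sum w = (\<Sum>l\<leftarrow>w. if snd l then 1 else -1)"

lemma exp_sum_simps [simp]:
  "exp_sum [] = 0"
  "exp_sum (l # w) = (if snd l then 1 else -1) + exp_sum w"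
  by (simp_all add: exp_sum_def)

text \<open>A cancelled pair contributes 1 - 1 = 0.\<close>

lemma exp_sum_mult: "exp_sum (foldr cons_reduce u v) = exp_sum u + exp_sum v"
proof (induction u)
  case (Cons a u)
  have "exp_sum (cons_reduce a w) = exp_sum [a] + exp_sum w" for w
    by (auto simp: cons_reduce_def flip_def split: list.splits)
  with Cons show ?case by simp
qed simp

lemma exp_sum_le_length: "exp_sum w \<le> length w"
  by (induction w) auto

lemma group_F2: "group F2"
  unfolding F2_def by (rule group_free_group)

lemma F2_simps:
  "carrier F2 = {w. reduced_word w \<and> fst ` set w \<subseteq> {0, 1}}"
  "mult F2 = foldr cons_reduce"
  "\<one>\<^bsub>F2\<^esub> = []"
  by (simp_all add: F2_def free_group_def)

lemma inv_F2:
  assumes "u \<in> carrier F2"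
  shows "inv\<^bsub>F2\<^esub> u = rev (map flip u)"
proof (rule group.inv_equality[OF group_F2])
  show "rev (map flip u) \<otimes>\<^bsub>F2\<^esub> u = \<one>\<^bsub>F2\<^esub>"
    using assms mult_inverse[of "[]" u] by (simp add: F2_simps mult_Nil_right)
  show "rev (map flip u) \<in> carrier F2"
    using assms by (auto simp: F2_simps reduced_inverse)
qed (fact assms)

section \<open>The slow and fast generators of the product\<close>

abbreviation FF :: "((nat \<times> bool) list \<times> (nat \<times> bool) list) monoid"
  where "FF \<equiv> F2 \<times>\<times> F2"

lemma group_FF: "group FF"
  by (intro DirProd_group group_F2)

definition slow_gens :: "((nat \<times> bool) list \<times> (nat \<times> bool) list) set"
  where "slow_gens = (\<Union>x\<in>{0, 1}. {([(x, True)], []), ([], [(x, True)])})"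

definition fast_gens :: "((nat \<times> bool) list \<times> (nat \<times> bool) list) set"
  where "fast_gens =
    (\<Union>x\<in>{0, 1}. \<Union>y\<in>{0, 1}. {([(x, True), (x, True)], [(y, False), (y, False)])})"

definition gens :: "((nat \<times> bool) list \<times> (nat \<times> bool) list) set"
  where "gens = slow_gens \<union> fast_gens"

lemma gens_carrier: "gens \<subseteq> carrier FF"
  by (auto simp: gens_def slow_gens_def fast_gens_def DirProd_def F2_simps reduced_Cons flip_def)

lemma inv_FF:
  assumes "(u, v) \<in> carrier FF"
  shows "inv\<^bsub>FF\<^esub> (u, v) = (rev (map flip u), rev (map flip v))"
  using assms group_F2 by (simp add: inv_DirProd inv_F2)

text \<open>Makes the inverses explicit words, so that a claim about all letters can be checked by
  enumeration.\<close>

lemma inv_gens: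
  "m_inv FF ` gens = (\<lambda>(u, v). (rev (map flip u), rev (map flip v))) ` gens"
  using gens_carrier by (intro image_cong) (auto simp: inv_FF subset_iff)

lemma slow_letter:
  assumes "x \<in> {0, 1}"
  shows "([(x, s)], []) \<in> gens \<union> m_inv FF ` gens"
    and "([], [(x, s)]) \<in> gens \<union> m_inv FF ` gens"
  unfolding inv_gens using assms
  by (cases s; force simp: gens_def slow_gens_def fast_gens_def flip_def)+

lemma fast_letter:
  assumes "x \<in> {0, 1}" "y \<in> {0, 1}"
  shows "([(x, s), (x, s)], [(y, \<not> s), (y, \<not> s)]) \<in> gens \<union> m_inv FF ` gens"
  unfolding inv_gens using assms
  by (cases s) (force simp: gens_def slow_gens_def fast_gens_def flip_def)+

text \<open>The budget of one step. A fast generator spends all of 2 on length; a slow one uses 3/2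
  in the coordinate that it moves and 1/2 in the other. The weight 1/2 of the exponent sum is the
  one for which the intermediate values cancel in \<open>two_passages_bound\<close>.\<close>

lemma generator_bounds:
  assumes "(c, e) \<in> gens \<union> m_inv FF ` gens"
  shows "reduced_word c" "reduced_word e" "length c \<le> 2" "length e \<le> 2"
    "length c + \<bar>exp_sum c + exp_sum e\<bar> / 2 \<le> 2" "length e + \<bar>exp_sum c + exp_sum e\<bar> / 2 \<le> 2"
  using assms unfolding inv_gens
  by (auto simp: gens_def slow_gens_def fast_gens_def flip_def reduced_Cons)

text \<open>In each factor a reduced word is peeled from the left into slow letters; being reduced,
  it is rebuilt without cancellation.\<close>

lemma finite_generating_set_gens: "finite_generating_set FF gens"
  unfolding finite_generating_set_def
proof (intro conjI gens_carrier)
  show "finite gens" by (simp add: gens_def slow_gens_def fast_gens_def)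
  interpret group FF by (rule group_FF)
  have gen: "c \<in> generate FF gens" if "c \<in> gens \<union> m_inv FF ` gens" for c
    using that by (auto intro: generate.incl generate.inv)
  have 1: "(u, []) \<in> generate FF gens" if "reduced_word u" "fst ` set u \<subseteq> {0, 1}" for u
    using that
  proof (induction u)
    case Nil
    then show ?case using generate.one[of FF gens] by (simp add: DirProd_def F2_simps)
  next
    case (Cons l u)
    then have "(u, []) \<in> generate FF gens" by (simp add: reduced_Cons)
    moreover have "([l], []) \<in> generate FF gens"
      using Cons.prems slow_letter(1)[of "fst l" "snd l"] by (intro gen) auto
    ultimately have "([l], []) \<otimes>\<^bsub>FF\<^esub> (u, []) \<in> generate FF gens" by (rule generate.eng[rotated])
    then show ?case using Cons.prems by (simp add: F2_simps cons_reduce_eq_Cons)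
  qed
  have 2: "([], u) \<in> generate FF gens" if "reduced_word u" "fst ` set u \<subseteq> {0, 1}" for u
    using that
  proof (induction u)
    case Nil
    then show ?case using generate.one[of FF gens] by (simp add: DirProd_def F2_simps)
  next
    case (Cons l u)
    then have "([], u) \<in> generate FF gens" by (simp add: reduced_Cons)
    moreover have "([], [l]) \<in> generate FF gens"
      using Cons.prems slow_letter(2)[of "fst l" "snd l"] by (intro gen) auto
    ultimately have "([], [l]) \<otimes>\<^bsub>FF\<^esub> ([], u) \<in> generate FF gens" by (rule generate.eng[rotated])
    then show ?case using Cons.prems by (simp add: F2_simps cons_reduce_eq_Cons)
  qed
  show "generate FF gens = carrier FF"
  proof
    show "generate FF gens \<subseteq> carrier FF" by (rule generate_incl[OF gens_carrier])
    show "carrier FF \<subseteq> generate FF gens"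
    proof
      fix p assume "p \<in> carrier FF"
      then obtain u v where p: "p = (u, v)" and uv: "u \<in> carrier F2" "v \<in> carrier F2"
        by (auto simp: DirProd_def)
      have "(u, []) \<otimes>\<^bsub>FF\<^esub> ([], v) \<in> generate FF gens"
        using uv by (intro generate.eng 1 2) (auto simp: F2_simps)
      then show "p \<in> generate FF gens"
        using p uv by (simp add: F2_simps mult_Nil_right)
    qed
  qed
qed

section \<open>The flat\<close>

text \<open>A geodesic line through the identity in the tree of the free group. It is not a
  subgroup: the two rays use different letters.\<close>

definition arm :: "int \<Rightarrow> (nat \<times> bool) list"
  where "arm i = (if 0 \<le> i then replicate (nat i) (0, True) else replicate (nat (- i)) (1, True))"

lemma reduced_replicate: "reduced_word (replicate n l)"
  by (induction n) (auto simp: reduced_Cons hd_replicate)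

lemma arm_carrier: "arm i \<in> carrier F2"
  by (auto simp: arm_def F2_simps reduced_replicate)

lemma arm_FF: "(arm i, arm j) \<in> carrier FF"
  by (simp add: DirProd_def arm_carrier)

lemma arm_reduced: "reduced_word (arm i)"
  by (simp add: arm_def reduced_replicate)

lemma length_arm [simp]: "real (length (arm i)) = \<bar>real_of_int i\<bar>"
  by (simp add: arm_def)

lemma exp_sum_replicate [simp]: "exp_sum (replicate n (x, True)) = n"
  by (induction n) auto

lemma exp_sum_arm [simp]: "exp_sum (arm i) = \<bar>real_of_int i\<bar>"
  by (simp add: arm_def)

definition flat_dist :: "int \<Rightarrow> int \<Rightarrow> int \<Rightarrow> int \<Rightarrow> real"
  where "flat_dist i j i' j' = word_dist FF gens (arm i, arm j) (arm i', arm j')"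

lemma flat_dist_commute: "flat_dist i j i' j' = flat_dist i' j' i j"
  unfolding flat_dist_def
  by (intro group.word_dist_commute[OF group_FF finite_generating_set_gens] arm_FF)

lemma flat_dist_refl [simp]: "flat_dist i j i j = 0"
  unfolding flat_dist_def
  using group.word_dist_eq_0_iff[OF group_FF finite_generating_set_gens arm_FF arm_FF] by blast

lemma flat_dist_triangle: "flat_dist i j i'' j'' \<le> flat_dist i j i' j' + flat_dist i' j' i'' j''"
  unfolding flat_dist_def
  by (intro group.word_dist_triangle[OF group_FF finite_generating_set_gens] arm_FF)

section \<open>Lower bounds for distances in the flat\<close>

lemma abs_diff_sum_telescope:
  fixes f p :: "nat \<Rightarrow> real"
  assumes "\<And>k. k < n \<Longrightarrow> \<bar>f (Suc k) - f k\<bar> + \<bar>p (Suc k) - p k\<bar> / 2 \<le> 2" "i \<le> j" "j \<le> n"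
  shows "\<bar>f j - f i\<bar> + \<bar>p j - p i\<bar> / 2 \<le> 2 * (real j - real i)"
  using assms(2,3)
proof (induction j rule: dec_induct)
  case (step j)
  then have "\<bar>f j - f i\<bar> + \<bar>p j - p i\<bar> / 2 \<le> 2 * (real j - real i)"
    "\<bar>f (Suc j) - f j\<bar> + \<bar>p (Suc j) - p j\<bar> / 2 \<le> 2"
    using assms(1)[of j] by auto
  moreover have "\<bar>f (Suc j) - f i\<bar> \<le> \<bar>f (Suc j) - f j\<bar> + \<bar>f j - f i\<bar>"
    "\<bar>p (Suc j) - p i\<bar> \<le> \<bar>p (Suc j) - p j\<bar> + \<bar>p j - p i\<bar>"
    by linarith+
  ultimately show ?case unfolding of_nat_Suc by argo
qed simp

text \<open>Here \<open>f\<close> and \<open>g\<close> are the lengths of the two coordinates along a path and \<open>p\<close> is the total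
  exponent sum. A path that first brings \<open>f\<close> and then \<open>g\<close> near zero must build up \<open>g\<close>, and
  then \<open>f\<close>, to about the size of \<open>p\<close>, unless it pays for a change of \<open>p\<close>.\<close>

lemma two_passages_bound:
  fixes f g p :: "nat \<Rightarrow> real"
  assumes f: "\<And>k. k < n \<Longrightarrow> \<bar>f (Suc k) - f k\<bar> + \<bar>p (Suc k) - p k\<bar> / 2 \<le> 2"
    and g: "\<And>k. k < n \<Longrightarrow> \<bar>g (Suc k) - g k\<bar> + \<bar>p (Suc k) - p k\<bar> / 2 \<le> 2"
    and p: "\<And>k. p k \<le> f k + g k"
    and kl: "k \<le> l" "l \<le> n" "f k \<le> 1" "g l \<le> 1"
  shows "f 0 + g n + (p 0 + p n) / 2 - 4 \<le> 2 * real n"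
proof -
  note F = abs_diff_sum_telescope[where f = f and p = p and n = n, rotated, OF _ _ f]
    and G = abs_diff_sum_telescope[where f = g and p = p and n = n, rotated, OF _ _ g]
  have "\<bar>f k - f 0\<bar> + \<bar>p k - p 0\<bar> / 2 \<le> 2 * (real k - real 0)"
    "\<bar>f l - f k\<bar> + \<bar>p l - p k\<bar> / 2 \<le> 2 * (real l - real k)"
    "\<bar>g l - g k\<bar> + \<bar>p l - p k\<bar> / 2 \<le> 2 * (real l - real k)"
    "\<bar>g n - g l\<bar> + \<bar>p n - p l\<bar> / 2 \<le> 2 * (real n - real l)"
    using kl F[of 0 k] F[of k l] G[of k l] G[of l n] by simp_all
  \<comment> \<open>Between \<open>k\<close> and \<open>l\<close> the exponent sum is dropped and
    the mean of the bounds for \<open>f\<close> and \<open>g\<close> is used. As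
    \<open>g k \<ge> p k - f k\<close> and \<open>f l \<ge> p l - g l\<close>, this mean supplies
    \<open>(p k + p l) / 2\<close>, exactly what the outer segments lose. The remainder
    \<open>2 * (f k + g l)\<close> is at most 4.\<close>
  then have "f 0 - f k + (p 0 - p k) / 2 \<le> 2 * real k" "f l - f k \<le> 2 * (real l - real k)"
    "g k - g l \<le> 2 * (real l - real k)" "g n - g l + (p n - p l) / 2 \<le> 2 * (real n - real l)"
    unfolding of_nat_0 by argo+
  then show ?thesis using p[of k] p[of l] kl(3,4) by argo
qed

locale cayley_path =
  fixes P :: "nat \<Rightarrow> (nat \<times> bool) list \<times> (nat \<times> bool) list" and n :: nat
  assumes P_carrier: "\<And>k. P k \<in> carrier FF"
    and P_step: "\<And>k. k < n \<Longrightarrow> \<exists>c\<in>gens \<union> m_inv FF ` gens. P (Suc k) = P k \<otimes>\<^bsub>FF\<^esub> c"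
begin

lemma path_reduced: "reduced_word (fst (P k))" "reduced_word (snd (P k))"
  using P_carrier[of k] by (auto simp: DirProd_def F2_simps)

lemma path_step:
  assumes "k < n"
  obtains c e where "(c, e) \<in> gens \<union> m_inv FF ` gens"
    "fst (P (Suc k)) = foldr cons_reduce (fst (P k)) c"
    "snd (P (Suc k)) = foldr cons_reduce (snd (P k)) e"
proof -
  obtain c e where ce: "(c, e) \<in> gens \<union> m_inv FF ` gens" "P (Suc k) = P k \<otimes>\<^bsub>FF\<^esub> (c, e)"
    using P_step[OF assms] by auto
  then show thesis using that[OF ce(1)] by (cases "P k") (simp add: F2_simps)
qed

text \<open>Whatever cancels, a length changes by at most the length of the factor multiplied on,
  while the exponent sum changes by exactly that of the generator.\<close>

lemma path_step_bounds:
  fixes k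
  defines "p \<equiv> \<lambda>k. exp_sum (fst (P k)) + exp_sum (snd (P k))"
  assumes "k < n"
  shows "\<bar>real (length (fst (P (Suc k)))) - length (fst (P k))\<bar> + \<bar>p (Suc k) - p k\<bar> / 2 \<le> 2"
    and "\<bar>real (length (snd (P (Suc k)))) - length (snd (P k))\<bar> + \<bar>p (Suc k) - p k\<bar> / 2 \<le> 2"
proof -
  obtain c e where ce: "(c, e) \<in> gens \<union> m_inv FF ` gens"
    "fst (P (Suc k)) = foldr cons_reduce (fst (P k)) c"
    "snd (P (Suc k)) = foldr cons_reduce (snd (P k)) e" using path_step[OF assms(2)] .
  note b = generator_bounds[OF ce(1)]
  have "p (Suc k) - p k = exp_sum c + exp_sum e"
    by (simp add: p_def ce exp_sum_mult)
  then show "\<bar>real (length (fst (P (Suc k)))) - length (fst (P k))\<bar> + \<bar>p (Suc k) - p k\<bar> / 2 \<le> 2"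
    "\<bar>real (length (snd (P (Suc k)))) - length (snd (P k))\<bar> + \<bar>p (Suc k) - p k\<bar> / 2 \<le> 2"
    using b(5,6) length_mult_diff[OF path_reduced(1) b(1), of k] length_mult_diff[OF path_reduced(2) b(2), of k]
    unfolding ce(2,3) by argo+
qed

end

text \<open>As long as the words have length at least 2, \<open>hd_mult_short\<close> keeps their
  first letter constant, but arms of opposite sign begin with different letters. If an index is 0,
  that end of the path is itself short.\<close>

lemma arm_passage:
  fixes u :: "nat \<Rightarrow> (nat \<times> bool) list"
  assumes red: "\<And>k. reduced_word (u k)"
    and step: "\<And>k. k < n \<Longrightarrow> \<exists>c. reduced_word c \<and> length c \<le> 2 \<and> u (Suc k) = foldr cons_reduce (u k) c"
    and ends: "u 0 = arm i" "u n = arm i'" "i * i' \<le> 0"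
  obtains k where "k \<le> n" "length (u k) \<le> 1"
proof (rule ccontr)
  assume "\<not> thesis"
  then have long: "2 \<le> length (u k)" if "k \<le> n" for k
    using that \<open>\<And>k. k \<le> n \<Longrightarrow> length (u k) \<le> 1 \<Longrightarrow> thesis\<close> by fastforce
  have "hd (u k) = hd (u 0)" if "k \<le> n" for k
    using that
  proof (induction k)
    case (Suc k)
    obtain c where c: "reduced_word c" "length c \<le> 2" "u (Suc k) = foldr cons_reduce (u k) c"
      using step[of k] Suc.prems by auto
    have "hd (u (Suc k)) = hd (u k)"
      unfolding c(3) using long[of k] long[of "Suc k"] Suc.prems c
      by (intro hd_mult_short red) auto
    with Suc show ?case by simp
  qed simp
  from this[of n] have hd: "hd (arm i') = hd (arm i)" using ends by simp
  have "2 \<le> \<bar>real_of_int i\<bar>" "2 \<le> \<bar>real_of_int i'\<bar>"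
    using long[of 0] long[of n] ends(1,2) by (simp_all flip: length_arm)
  then have "i \<noteq> 0" "i' \<noteq> 0" by auto
  with hd ends(3) show False
    by (auto simp: arm_def mult_le_0_iff split: if_splits)
qed

text \<open>Both bounds are read off one shortest path; the factor 2 is the greatest change of a
  coordinate length in one step. The first bound looks at one coordinate at a time, the second at
  the order of the two passages.\<close>

lemma
  shows flat_dist_ge_max: "max \<bar>real_of_int i - i'\<bar> \<bar>real_of_int j - j'\<bar> - 2 \<le> 2 * flat_dist i j i' j'"
    and flat_dist_ge_opposite: "\<lbrakk>i * i' \<le> 0; j * j' \<le> 0\<rbrakk> \<Longrightarrow>
      min (\<bar>real_of_int i\<bar> + \<bar>real_of_int j'\<bar>) (\<bar>real_of_int j\<bar> + \<bar>real_of_int i'\<bar>)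
        + (\<bar>real_of_int i\<bar> + \<bar>real_of_int j\<bar> + \<bar>real_of_int i'\<bar> + \<bar>real_of_int j'\<bar>) / 2 - 4
      \<le> 2 * flat_dist i j i' j'"
proof -
  define n where "n = word_length FF gens (inv\<^bsub>FF\<^esub> (arm i, arm j) \<otimes>\<^bsub>FF\<^esub> (arm i', arm j'))"
  have n: "flat_dist i j i' j' = n" by (simp add: flat_dist_def word_dist_def n_def)
  obtain P where P: "P 0 = (arm i, arm j)" "P n = (arm i', arm j')" "\<And>k. P k \<in> carrier FF"
    "\<And>k. k < n \<Longrightarrow> \<exists>c\<in>gens \<union> m_inv FF ` gens. P (Suc k) = P k \<otimes>\<^bsub>FF\<^esub> c"
    using group.word_length_path[OF group_FF finite_generating_set_gens arm_FF arm_FF]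
    unfolding n_def by metis
  interpret cayley_path P n using P(3,4) by unfold_locales
  define f where "f k = real (length (fst (P k)))" for k
  define g where "g k = real (length (snd (P k)))" for k
  define p where "p k = exp_sum (fst (P k)) + exp_sum (snd (P k))" for k
  have ends: "f 0 = \<bar>real_of_int i\<bar>" "g 0 = \<bar>real_of_int j\<bar>" "f n = \<bar>real_of_int i'\<bar>" "g n = \<bar>real_of_int j'\<bar>"
    "p 0 = \<bar>real_of_int i\<bar> + \<bar>real_of_int j\<bar>" "p n = \<bar>real_of_int i'\<bar> + \<bar>real_of_int j'\<bar>"
    by (simp_all add: f_def g_def p_def P)
  have f: "\<bar>f (Suc k) - f k\<bar> + \<bar>p (Suc k) - p k\<bar> / 2 \<le> 2"
    and g: "\<bar>g (Suc k) - g k\<bar> + \<bar>p (Suc k) - p k\<bar> / 2 \<le> 2" if "k < n" for k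
    using path_step_bounds[OF that] by (simp_all add: f_def g_def p_def)
  have p: "p k \<le> f k + g k" for k
    by (simp add: p_def f_def g_def add_mono exp_sum_le_length)
  have step: "\<exists>c. reduced_word c \<and> length c \<le> 2 \<and> fst (P (Suc k)) = foldr cons_reduce (fst (P k)) c"
    "\<exists>c. reduced_word c \<and> length c \<le> 2 \<and> snd (P (Suc k)) = foldr cons_reduce (snd (P k)) c"
    if "k < n" for k
    using path_step[OF that] generator_bounds by metis+
  have f0: "\<exists>k\<le>n. f k \<le> 1" if "i * i' \<le> 0"
    using arm_passage[of "\<lambda>k. fst (P k)" n i i', OF path_reduced(1) step(1)] P that
    by (metis f_def fst_conv of_nat_1 of_nat_le_iff)
  have g0: "\<exists>k\<le>n. g k \<le> 1" if "j * j' \<le> 0"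
    using arm_passage[of "\<lambda>k. snd (P k)" n j j', OF path_reduced(2) step(2)] P that
    by (metis g_def snd_conv of_nat_1 of_nat_le_iff)
  \<comment> \<open>Here \<open>h\<close> is the length of either coordinate. For indices of equal
    sign it changes by exactly the difference of the indices. Otherwise it has to come down to at
    most 1 and grow again, which costs the constant 2.\<close>
  have line: "\<bar>real_of_int a - a'\<bar> - 2 \<le> 2 * real n"
    if h: "\<And>k. k < n \<Longrightarrow> \<bar>h (Suc k) - h k\<bar> + \<bar>p (Suc k) - p k\<bar> / 2 \<le> 2"
      and e: "h 0 = \<bar>real_of_int a\<bar>" "h n = \<bar>real_of_int a'\<bar>" and h0: "a * a' \<le> 0 \<Longrightarrow> \<exists>k\<le>n. h k \<le> 1"
    for h a a'
  proof (cases "a * a' \<le> 0")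
    case True
    then obtain k where "k \<le> n" "h k \<le> 1" using h0 by blast
    have "\<bar>h k - h 0\<bar> + \<bar>p k - p 0\<bar> / 2 \<le> 2 * (real k - real 0)"
      "\<bar>h n - h k\<bar> + \<bar>p n - p k\<bar> / 2 \<le> 2 * (real n - real k)"
      using \<open>k \<le> n\<close> by (intro abs_diff_sum_telescope[of n h p] h; simp)+
    then have "h 0 - h k \<le> 2 * real k" "h n - h k \<le> 2 * real n - 2 * real k"
      unfolding of_nat_0 by argo+
    then show ?thesis
      using \<open>h k \<le> 1\<close> e abs_triangle_ineq4[of "real_of_int a" "real_of_int a'"] by argo
  next
    case False
    then have "\<bar>real_of_int a - a'\<bar> = \<bar>h n - h 0\<bar>"
      using e by (auto simp: not_le zero_less_mult_iff)
    moreover have "\<bar>h n - h 0\<bar> + \<bar>p n - p 0\<bar> / 2 \<le> 2 * (real n - real 0)"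
      by (intro abs_diff_sum_telescope[of n h p] h; simp)
    ultimately show ?thesis using abs_ge_zero[of "p n - p 0"] unfolding of_nat_0 by argo
  qed
  show "max \<bar>real_of_int i - i'\<bar> \<bar>real_of_int j - j'\<bar> - 2 \<le> 2 * flat_dist i j i' j'"
    using line[of f i i', OF f] line[of g j j', OF g] ends f0 g0 n by (simp add: max_def)
  assume "i * i' \<le> 0" "j * j' \<le> 0"
  then obtain k l where kl: "k \<le> n" "f k \<le> 1" "l \<le> n" "g l \<le> 1" using f0 g0 by blast
  show "min (\<bar>real_of_int i\<bar> + \<bar>real_of_int j'\<bar>) (\<bar>real_of_int j\<bar> + \<bar>real_of_int i'\<bar>)
        + (\<bar>real_of_int i\<bar> + \<bar>real_of_int j\<bar> + \<bar>real_of_int i'\<bar> + \<bar>real_of_int j'\<bar>) / 2 - 4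
      \<le> 2 * flat_dist i j i' j'"
  proof (cases "k \<le> l")
    case True
    have "f 0 + g n + (p 0 + p n) / 2 - 4 \<le> 2 * real n"
      by (rule two_passages_bound[OF f g p True kl(3,2,4)])
    then show ?thesis
      unfolding ends n
      using min.cobounded1[of "\<bar>real_of_int i\<bar> + \<bar>real_of_int j'\<bar>" "\<bar>real_of_int j\<bar> + \<bar>real_of_int i'\<bar>"]
      by argo
  next
    case False
    \<comment> \<open>The second coordinate passes first. Exchanging the roles of \<open>f\<close>
      and \<open>g\<close> yields the other term of the minimum.\<close>
    have "p k \<le> g k + f k" for k using p[of k] by simp
    then have "g 0 + f n + (p 0 + p n) / 2 - 4 \<le> 2 * real n"
      using False by (intro two_passages_bound[OF g f _ _ kl(1,4,2)]) auto
    then show ?thesis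
      unfolding ends n
      using min.cobounded2[of "\<bar>real_of_int i\<bar> + \<bar>real_of_int j'\<bar>" "\<bar>real_of_int j\<bar> + \<bar>real_of_int i'\<bar>"]
      by argo
  qed
qed

section \<open>Upper bounds for distances in the flat\<close>

lemma arm_ray:
  assumes "s = 1 \<or> s = - 1"
  shows "arm (s * int k) = replicate k (if s = 1 then 0 else 1, True)"
  using assms by (cases "k = 0") (auto simp: arm_def)

lemma mult_append: "reduced_word (u @ v) \<Longrightarrow> foldr cons_reduce u v = u @ v"
  by (induction u) (auto simp: reduced_Cons hd_append cons_reduce_eq_Cons split: if_splits)

lemma mult_replicate:
  "foldr cons_reduce (replicate m l) (replicate n l) = replicate (m + n) l"
  using mult_append[of "replicate m l" "replicate n l"] reduced_replicate[of "m + n" l]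
  by (simp add: replicate_add del: foldr_replicate)

lemma mult_replicate_flip:
  "foldr cons_reduce (replicate (m + n) l) (replicate n (flip l)) = replicate m l"
proof (induction n)
  case 0
  then show ?case using mult_Nil_right[OF reduced_replicate, of m l] by (simp del: foldr_replicate)
next
  case (Suc n)
  have "foldr cons_reduce (replicate (m + Suc n) l) (replicate (Suc n) (flip l)) =
      foldr cons_reduce (foldr cons_reduce (replicate (m + Suc n) l) [flip l]) (replicate n (flip l))"
    using mult_Cons_letter[of "flip l" "replicate n (flip l)"] reduced_replicate[of "Suc n" "flip l"]
    by (simp del: foldr_replicate foldr.simps)
  also have "foldr cons_reduce (replicate (m + Suc n) l) [flip l] = replicate (m + n) l"
    using mult_letter[OF reduced_replicate, of "m + Suc n" l "flip l"]
    by (simp add: butlast_conv_take del: foldr_replicate replicate.simps foldr.simps)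
  finally show ?case using Suc by simp
qed

lemma flat_dist_le_1:
  assumes "c \<in> gens \<union> m_inv FF ` gens" "(arm i, arm j) \<otimes>\<^bsub>FF\<^esub> c = (arm i', arm j')"
  shows "flat_dist i j i' j' \<le> 1"
  using group.word_dist_mult_le_1[OF group_FF gens_carrier arm_FF[of i j] assms(1)] assms(2)
  by (simp add: flat_dist_def)

lemma flat_dist_slow:
  shows "flat_dist i j (i + 1) j \<le> 1" "flat_dist i j i (j + 1) \<le> 1"
proof -
  have ray: "foldr cons_reduce (arm (s * int k)) [(if s = 1 then 0 else 1, True)] = arm (s * int (k + 1))"
    if "s = 1 \<or> s = - 1" for s k
    unfolding arm_ray[OF that]
    using mult_replicate[of k "(if s = 1 then 0 else 1, True)" 1] by (simp del: foldr_replicate)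
  have 1: "flat_dist (s * int k) j (s * int (k + 1)) j \<le> 1" if "s = 1 \<or> s = - 1" for s k j
    by (rule flat_dist_le_1[OF slow_letter(1)[of "if s = 1 then 0 else 1" True]])
       (use that in \<open>simp_all only: F2_simps ray mult_Nil_right arm_reduced DirProd_mult, auto\<close>)
  have 2: "flat_dist i (s * int k) i (s * int (k + 1)) \<le> 1" if "s = 1 \<or> s = - 1" for s k i
    by (rule flat_dist_le_1[OF slow_letter(2)[of "if s = 1 then 0 else 1" True]])
       (use that in \<open>simp_all only: F2_simps ray mult_Nil_right arm_reduced DirProd_mult, auto\<close>)
  \<comment> \<open>On the negative ray \<open>i + 1\<close> is nearer to the identity than
    \<open>i\<close>, so the outward step leads from \<open>i + 1\<close> to \<open>i\<close> and is
    used backwards.\<close>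
  show "flat_dist i j (i + 1) j \<le> 1"
    unfolding add.commute[of i 1] using 1[of 1 "nat i" j] 1[of "- 1" "nat (- i - 1)" j] flat_dist_commute[of i j "1 + i" j]
    by (cases "0 \<le> i") auto
  show "flat_dist i j i (j + 1) \<le> 1"
    unfolding add.commute[of j 1] using 2[of 1 i "nat j"] 2[of "- 1" i "nat (- j - 1)"] flat_dist_commute[of i j i "1 + j"]
    by (cases "0 \<le> j") auto
qed

lemma flat_dist_le_sum: "flat_dist i j i' j' \<le> \<bar>real_of_int i - i'\<bar> + \<bar>real_of_int j - j'\<bar>"
proof -
  have 1: "flat_dist i j (i + int n) j \<le> n" for i j n
  proof (induction n)
    case (Suc n)
    then show ?case
      using flat_dist_slow(1)[of "i + int n" j] flat_dist_triangle[of i j "i + int (Suc n)" j "i + int n" j]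
      by (simp add: ac_simps)
  qed simp
  have 2: "flat_dist i j i (j + int n) \<le> n" for i j n
  proof (induction n)
    case (Suc n)
    then show ?case
      using flat_dist_slow(2)[of i "j + int n"] flat_dist_triangle[of i j i "j + int (Suc n)" i "j + int n"]
      by (simp add: ac_simps)
  qed simp
  have "flat_dist i j i' j \<le> \<bar>real_of_int i - i'\<bar>"
    using 1[of i j "nat (i' - i)"] 1[of i' j "nat (i - i')"] flat_dist_commute[of i j i' j]
    by (cases "i \<le> i'") auto
  moreover have "flat_dist i' j i' j' \<le> \<bar>real_of_int j - j'\<bar>"
    using 2[of i' j "nat (j' - j)"] 2[of i' j' "nat (j - j')"] flat_dist_commute[of i' j i' j']
    by (cases "j \<le> j'") auto
  ultimately show ?thesis using flat_dist_triangle[of i j i' j' i' j] by simp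
qed

lemma flat_dist_fast:
  assumes s: "s = 1 \<or> s = - 1" and t: "t = 1 \<or> t = - 1"
  shows "flat_dist (s * int k) (t * int (l + 2 * n)) (s * int (k + 2 * n)) (t * int l) \<le> n"
proof (induction n arbitrary: l)
  case (Suc n)
  define x y :: nat where "x = (if s = 1 then 0 else 1)" and "y = (if t = 1 then 0 else 1)"
  have xy: "x \<in> {0, 1}" "y \<in> {0, 1}" by (simp_all add: x_def y_def)
  have 1: "foldr cons_reduce (arm (s * int k)) [(x, True), (x, True)] = arm (s * int (k + 2))" for k
    using mult_replicate[of k "(x, True)" 2]
    unfolding arm_ray[OF s] x_def[symmetric] by (simp add: numeral_2_eq_2 del: foldr_replicate)
  have 2: "foldr cons_reduce (arm (t * int (l + 2))) [(y, False), (y, False)] = arm (t * int l)"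
  proof -
    have "replicate 2 (flip (y, True)) = [(y, False), (y, False)]"
      by (simp add: numeral_2_eq_2 flip_def)
    then show ?thesis
      using mult_replicate_flip[of l 2 "(y, True)"] unfolding arm_ray[OF t] y_def[symmetric] by argo
  qed
  have "flat_dist (s * int k) (t * int (l + 2)) (s * int (k + 2)) (t * int l) \<le> 1" for k
    by (rule flat_dist_le_1[OF fast_letter[OF xy, of True]]) (simp only: F2_simps DirProd_mult 1 2 not_True_eq_False)
  from this[of "k + 2 * n"] Suc.IH[of "l + 2"] show ?case
    using flat_dist_triangle[of "s * int k" "t * int (l + 2 * Suc n)" "s * int (k + 2 * Suc n)" "t * int l"
      "s * int (k + 2 * n)" "t * int (l + 2)"]
    by (simp add: algebra_simps)
qed simp

text \<open>Fast steps run along the side of the square at speed 2. The tolerance 2 leaves room for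
  rounding both coordinates of both points; the constant 5 absorbs it together with parity
  defects.\<close>

lemma flat_dist_le_diamond:
  fixes k l k' l' :: nat
  assumes s: "s = 1 \<or> s = - 1" and t: "t = 1 \<or> t = - 1"
    and "\<bar>real k + real l - (real k' + real l')\<bar> \<le> 2"
  shows "flat_dist (s * int k) (t * int l) (s * int k') (t * int l') \<le> \<bar>real k - real k'\<bar> / 2 + 5"
  using assms(3)
proof (induction k k' arbitrary: l l' rule: linorder_wlog)
  case (le k k')
  \<comment> \<open>The largest number of fast steps that neither carries the first coordinate
    beyond \<open>k'\<close> nor the second below 0. Slow steps cover the bounded rest.\<close>
  define n where "n = min ((k' - k) div 2) (l div 2)"
  have n: "k + 2 * n \<le> k'" "2 * n \<le> l" using le(1) by (auto simp: n_def)
  have "\<bar>real k + real l - (real k' + real l')\<bar> = \<bar>real_of_int (int k + int l - (int k' + int l'))\<bar>"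
    by simp
  then have sum: "\<bar>int k + int l - (int k' + int l')\<bar> \<le> 2"
    using le(2) by (metis of_int_abs of_int_le_numeral_iff)
  have d: "int k' - int (k + 2 * n) + \<bar>int l' - int (l - 2 * n)\<bar> \<le> 5"
  proof (cases "(k' - k) div 2 \<le> l div 2")
    case True
    then have "k' = k + 2 * n \<or> k' = k + 2 * n + 1" using le(1) by (simp add: n_def) presburger
    then show ?thesis using sum n by (auto simp: of_nat_diff)
  next
    case False
    then have "l = 2 * n \<or> l = 2 * n + 1" by (simp add: n_def) presburger
    then show ?thesis using sum n by (auto simp: of_nat_diff)
  qed
  have "flat_dist (s * int k) (t * int l) (s * int (k + 2 * n)) (t * int (l - 2 * n)) \<le> n"
    using flat_dist_fast[OF s t, of k "l - 2 * n" n] n by simp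
  moreover have "real n \<le> \<bar>real k - real k'\<bar> / 2"
    using n(1) of_nat_mono[OF n(1), where 'a = real] by simp
  moreover have "flat_dist (s * int (k + 2 * n)) (t * int (l - 2 * n)) (s * int k') (t * int l') \<le> 5"
  proof -
    have "\<bar>s * int (k + 2 * n) - s * int k'\<bar> + \<bar>t * int (l - 2 * n) - t * int l'\<bar> \<le> 5"
    proof -
      have "\<bar>s * int (k + 2 * n) - s * int k'\<bar> = int k' - int (k + 2 * n)"
        "\<bar>t * int (l - 2 * n) - t * int l'\<bar> = \<bar>int l' - int (l - 2 * n)\<bar>"
        using s t n(1) by (elim disjE; simp)+
      then show ?thesis using d by simp
    qed
    then have "\<bar>real_of_int (s * int (k + 2 * n)) - real_of_int (s * int k')\<bar>
        + \<bar>real_of_int (t * int (l - 2 * n)) - real_of_int (t * int l')\<bar> \<le> 5"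
      by linarith
    then show ?thesis using flat_dist_le_sum order_trans by blast
  qed
  ultimately show ?case
    using flat_dist_triangle[of "s * int k" "t * int l" "s * int k'" "t * int l'"
      "s * int (k + 2 * n)" "t * int (l - 2 * n)"] by linarith
next
  case (sym k k')
  then show ?case
    using sym(1)[of l' l] flat_dist_commute[of "s * int k" "t * int l" "s * int k'" "t * int l'"]
    by (simp add: abs_minus_commute)
qed

section \<open>A non-principal ultrafilter\<close>

text \<open>If \<open>\<not> P\<close> is not eventual, restricting \<open>F\<close> to
  \<open>P\<close> gives a proper filter below \<open>F\<close>, which by minimality is
  \<open>F\<close> itself.\<close>

lemma minimal_filter_ultra:
  assumes "F \<noteq> bot" "\<And>G. G \<noteq> bot \<Longrightarrow> G \<le> F \<Longrightarrow> G = F"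
  shows "eventually P F \<or> eventually (\<lambda>x. \<not> P x) F"
proof (rule disjCI)
  assume "\<not> eventually (\<lambda>x. \<not> P x) F"
  then have "inf F (principal {x. P x}) \<noteq> bot"
    by (auto simp: trivial_limit_def eventually_inf_principal)
  then have "inf F (principal {x. P x}) = F" by (intro assms(2)) auto
  moreover have "eventually P (inf F (principal {x. P x}))"
    by (simp add: eventually_inf_principal)
  ultimately show "eventually P F" by simp
qed

lemma minimal_filter_ex:
  assumes "F0 \<noteq> (bot :: 'a filter)"
  obtains F where "F \<noteq> bot" "F \<le> F0" "\<And>G. G \<noteq> bot \<Longrightarrow> G \<le> F \<Longrightarrow> G = F"
proof -
  let ?A = "{F. F \<noteq> bot \<and> F \<le> F0}"
  have "\<exists>m\<in>?A. \<forall>a\<in>?A. m \<ge> a \<longrightarrow> a = m"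
  proof (rule predicate_Zorn)
    show "partial_order_on ?A (relation_of (\<ge>) ?A)"
      by (auto simp: partial_order_on_def preorder_on_def refl_on_def trans_def antisym_def relation_of_def)
  next
    fix C assume C: "C \<in> Chains (relation_of (\<ge>) ?A)"
    show "\<exists>u\<in>?A. \<forall>a\<in>C. a \<ge> u"
    proof (cases "C = {}")
      case True
      then show ?thesis using assms by auto
    next
      case False
      have CA: "C \<subseteq> ?A" using C by (auto simp: Chains_def relation_of_def)
      have "\<exists>x\<in>C. x \<le> inf F G" if "F \<in> C" "G \<in> C" for F G
        using C that by (auto simp: Chains_def relation_of_def inf_absorb1 inf_absorb2)
      \<comment> \<open>What holds eventually for the infimum of a chain already does so for a
        member. So \<open>False\<close> never does, and the infimum is a proper filter.\<close>
      then have ev: "eventually P (Inf C) \<longleftrightarrow> (\<exists>b\<in>C. eventually P b)" for P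
        by (intro eventually_Inf_base False)
      have "Inf C \<noteq> bot" using CA ev[of "\<lambda>_. False"] by (auto simp: trivial_limit_def)
      moreover have "Inf C \<le> F0" using False CA by (auto intro: Inf_lower2)
      ultimately show ?thesis by (auto intro: Inf_lower)
    qed
  qed
  then show thesis using that order_trans by blast
qed

text \<open>The second conclusion is recorded in order to carry ordinary limits of sequences over to
  \<open>\<omega>\<close>.\<close>

lemma nonprincipal_ultrafilter_ex:
  obtains \<omega> where "nonprincipal_ultrafilter \<omega>" "\<omega> \<le> sequentially"
proof -
  obtain F where F: "F \<noteq> bot" "F \<le> sequentially" "\<And>G. G \<noteq> bot \<Longrightarrow> G \<le> F \<Longrightarrow> G = F"
    using minimal_filter_ex[of sequentially] by auto
  have "\<not> eventually (\<lambda>m. m = n) F" for n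
  proof
    assume "eventually (\<lambda>m. m = n) F"
    moreover have "eventually (\<lambda>m. n < m) F"
      using F(2) eventually_gt_at_top filter_leD by blast
    ultimately have "eventually (\<lambda>_. False) F" by eventually_elim simp
    then show False using F(1) by (simp add: trivial_limit_def)
  qed
  then show thesis
    using that[of F] F minimal_filter_ultra[of F] by (auto simp: nonprincipal_ultrafilter_def)
qed

section \<open>A flat in the asymptotic cone\<close>

text \<open>A non-negative product means that the two indices lie on a common ray, so one sign
  serves both, even if one of them is 0.\<close>

lemma flat_dist_le_diamond_int:
  assumes "0 \<le> i * i'" "0 \<le> j * j'"
    "\<bar>(\<bar>real_of_int i\<bar> + \<bar>real_of_int j\<bar>) - (\<bar>real_of_int i'\<bar> + \<bar>real_of_int j'\<bar>)\<bar> \<le> 2"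
  shows "flat_dist i j i' j' \<le> \<bar>real_of_int i - i'\<bar> / 2 + 5"
proof -
  have sgn: "\<exists>s. (s = 1 \<or> s = - 1) \<and> a = s * int (nat \<bar>a\<bar>) \<and> a' = s * int (nat \<bar>a'\<bar>)"
    if "0 \<le> a * a'" for a a' :: int
    using that by (cases "0 \<le> a \<and> 0 \<le> a'") (auto simp: zero_le_mult_iff)
  obtain s where s: "s = 1 \<or> s = - 1" "i = s * int (nat \<bar>i\<bar>)" "i' = s * int (nat \<bar>i'\<bar>)"
    using sgn[OF assms(1)] by blast
  obtain t where t: "t = 1 \<or> t = - 1" "j = t * int (nat \<bar>j\<bar>)" "j' = t * int (nat \<bar>j'\<bar>)"
    using sgn[OF assms(2)] by blast
  have "\<bar>\<bar>real_of_int i\<bar> - \<bar>real_of_int i'\<bar>\<bar> = \<bar>real_of_int i - i'\<bar>"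
    using assms(1) by (auto simp: zero_le_mult_iff)
  moreover have "flat_dist (s * int (nat \<bar>i\<bar>)) (t * int (nat \<bar>j\<bar>)) (s * int (nat \<bar>i'\<bar>)) (t * int (nat \<bar>j'\<bar>))
      \<le> \<bar>real (nat \<bar>i\<bar>) - real (nat \<bar>i'\<bar>)\<bar> / 2 + 5"
    by (rule flat_dist_le_diamond[OF s(1) t(1)]) (use assms(3) in simp)
  ultimately show ?thesis using s(2,3) t(2,3) by simp
qed

text \<open>Rounding down lowers both absolute values if the numbers are non-negative and raises
  both if they are non-positive. So the two errors partly cancel and one coordinate costs at most 1;
  two coordinates give the tolerance 2 of \<open>flat_dist_le_diamond_int\<close>.\<close>

lemma floor_mult_nonneg:
  assumes "0 \<le> (u::real) * v"
  shows "0 \<le> \<lfloor>u\<rfloor> * \<lfloor>v\<rfloor>" "\<bar>(\<bar>real_of_int \<lfloor>u\<rfloor>\<bar> - \<bar>real_of_int \<lfloor>v\<rfloor>\<bar>) - (\<bar>u\<bar> - \<bar>v\<bar>)\<bar> \<le> 1"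
proof -
  have "0 \<le> u \<and> 0 \<le> v \<or> u \<le> 0 \<and> v \<le> 0" using assms by (simp add: zero_le_mult_iff)
  then have "(0 \<le> u \<and> 0 \<le> v \<and> 0 \<le> \<lfloor>u\<rfloor> \<and> 0 \<le> \<lfloor>v\<rfloor>) \<or> (u \<le> 0 \<and> v \<le> 0 \<and> \<lfloor>u\<rfloor> \<le> 0 \<and> \<lfloor>v\<rfloor> \<le> 0)"
    by linarith
  then show "0 \<le> \<lfloor>u\<rfloor> * \<lfloor>v\<rfloor>" "\<bar>(\<bar>real_of_int \<lfloor>u\<rfloor>\<bar> - \<bar>real_of_int \<lfloor>v\<rfloor>\<bar>) - (\<bar>u\<bar> - \<bar>v\<bar>)\<bar> \<le> 1"
    by (auto simp: zero_le_mult_iff) linarith+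
qed

lemma floor_mult_nonpos:
  assumes "(u::real) * v \<le> 0"
  shows "\<lfloor>u\<rfloor> * \<lfloor>v\<rfloor> \<le> 0"
proof -
  have "0 \<le> u \<and> v \<le> 0 \<or> u \<le> 0 \<and> 0 \<le> v" using assms by (simp add: mult_le_0_iff)
  then have "(0 \<le> \<lfloor>u\<rfloor> \<and> \<lfloor>v\<rfloor> \<le> 0) \<or> (\<lfloor>u\<rfloor> \<le> 0 \<and> 0 \<le> \<lfloor>v\<rfloor>)"
    by linarith
  then show ?thesis by (auto simp: mult_le_0_iff)
qed

section \<open>Rescaled distances with explicit rounding errors\<close>

definition scale :: "nat \<Rightarrow> real"
  where "scale n = real (Suc n)"

lemma scale_pos [simp]: "0 < scale n" "0 \<le> scale n" "scale n \<noteq> 0"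
  by (simp_all add: scale_def)

lemma scaling_sequence_scale: "scaling_sequence scale"
proof -
  have "filterlim scale at_top sequentially"
    unfolding scale_def
    using filterlim_compose[OF filterlim_real_sequentially filterlim_Suc] by simp
  then show ?thesis by (simp add: scaling_sequence_def)
qed

definition flat_seq :: "real \<Rightarrow> real \<Rightarrow> nat \<Rightarrow> (nat \<times> bool) list \<times> (nat \<times> bool) list"
  where "flat_seq x y n = (arm \<lfloor>scale n * x\<rfloor>, arm \<lfloor>scale n * y\<rfloor>)"

definition scaled_flat_dist :: "nat \<Rightarrow> real \<Rightarrow> real \<Rightarrow> real \<Rightarrow> real \<Rightarrow> real"
  where "scaled_flat_dist n x y x' y' =
    flat_dist \<lfloor>scale n * x\<rfloor> \<lfloor>scale n * y\<rfloor> \<lfloor>scale n * x'\<rfloor> \<lfloor>scale n * y'\<rfloor> / scale n"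

lemma scaled_flat_dist_word_dist:
  "scaled_flat_dist n x y x' y' = word_dist FF gens (flat_seq x y n) (flat_seq x' y' n) / scale n"
  by (simp add: scaled_flat_dist_def flat_seq_def flat_dist_def)

lemma floor_diff_le: "\<bar>real_of_int \<lfloor>u\<rfloor> - real_of_int \<lfloor>v\<rfloor>\<bar> \<le> \<bar>u - v\<bar> + 1"
  by linarith

lemma abs_floor_ge: "\<bar>u\<bar> - 1 \<le> \<bar>real_of_int \<lfloor>u\<rfloor>\<bar>"
  by linarith

lemma floor_diff_ge: "\<bar>u - v\<bar> - 1 \<le> \<bar>real_of_int \<lfloor>u\<rfloor> - real_of_int \<lfloor>v\<rfloor>\<bar>"
  by linarith

lemma abs_scale: "\<bar>scale n * x\<bar> = scale n * \<bar>x\<bar>" "\<bar>scale n * x - scale n * y\<bar> = scale n * \<bar>x - y\<bar>"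
  by (simp_all add: abs_mult less_imp_le flip: right_diff_distrib)

lemma divide_scale_le:
  assumes "D \<le> scale n * c + K" shows "D / scale n \<le> c + K / scale n"
  using assms by (simp add: pos_divide_le_eq distrib_left mult.commute[of _ "scale n"])

lemma divide_scale_ge:
  assumes "scale n * c - K \<le> D" shows "c - K / scale n \<le> D / scale n"
  using assms by (simp add: pos_le_divide_eq right_diff_distrib mult.commute[of _ "scale n"])

lemma scaled_flat_dist_le_sum:
  "scaled_flat_dist n x y x' y' \<le> (\<bar>x - x'\<bar> + \<bar>y - y'\<bar>) + 2 / scale n"
  unfolding scaled_flat_dist_def
proof (rule divide_scale_le)
  show "flat_dist \<lfloor>scale n * x\<rfloor> \<lfloor>scale n * y\<rfloor> \<lfloor>scale n * x'\<rfloor> \<lfloor>scale n * y'\<rfloor>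
      \<le> scale n * (\<bar>x - x'\<bar> + \<bar>y - y'\<bar>) + 2"
    using flat_dist_le_sum[of "\<lfloor>scale n * x\<rfloor>" "\<lfloor>scale n * y\<rfloor>" "\<lfloor>scale n * x'\<rfloor>" "\<lfloor>scale n * y'\<rfloor>"]
      floor_diff_le[of "scale n * x" "scale n * x'"] floor_diff_le[of "scale n * y" "scale n * y'"]
    by (simp add: abs_scale distrib_left)
qed

lemma abs_sum_diff_le:
  fixes a b c d a' b' c' d' :: real
  assumes "\<bar>(a - c) - (a' - c')\<bar> \<le> 1" "\<bar>(b - d) - (b' - d')\<bar> \<le> 1" "a' + b' = c' + d'"
  shows "\<bar>(a + b) - (c + d)\<bar> \<le> 2"
  using assms by linarith

lemma scaled_flat_dist_le_diamond:
  assumes "0 \<le> x * x'" "0 \<le> y * y'" "\<bar>x\<bar> + \<bar>y\<bar> = \<bar>x'\<bar> + \<bar>y'\<bar>"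
  shows "scaled_flat_dist n x y x' y' \<le> \<bar>x - x'\<bar> / 2 + 6 / scale n"
  unfolding scaled_flat_dist_def
proof (rule divide_scale_le)
  have nn: "0 \<le> (scale n * x) * (scale n * x')" "0 \<le> (scale n * y) * (scale n * y')"
    using mult_nonneg_nonneg[OF _ assms(1), of "scale n * scale n"]
      mult_nonneg_nonneg[OF _ assms(2), of "scale n * scale n"]
    by (simp_all add: mult_ac less_imp_le)
  have "scale n * \<bar>x\<bar> + scale n * \<bar>y\<bar> = scale n * \<bar>x'\<bar> + scale n * \<bar>y'\<bar>"
    using assms(3) by (simp flip: distrib_left)
  then have "\<bar>scale n * x\<bar> + \<bar>scale n * y\<bar> = \<bar>scale n * x'\<bar> + \<bar>scale n * y'\<bar>"
    by (simp add: abs_scale)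
  from abs_sum_diff_le[OF floor_mult_nonneg(2)[OF nn(1)] floor_mult_nonneg(2)[OF nn(2)] this]
  have "flat_dist \<lfloor>scale n * x\<rfloor> \<lfloor>scale n * y\<rfloor> \<lfloor>scale n * x'\<rfloor> \<lfloor>scale n * y'\<rfloor> \<le>
      \<bar>real_of_int \<lfloor>scale n * x\<rfloor> - \<lfloor>scale n * x'\<rfloor>\<bar> / 2 + 5"
    by (intro flat_dist_le_diamond_int floor_mult_nonneg(1) nn)
  then show "flat_dist \<lfloor>scale n * x\<rfloor> \<lfloor>scale n * y\<rfloor> \<lfloor>scale n * x'\<rfloor> \<lfloor>scale n * y'\<rfloor>
      \<le> scale n * (\<bar>x - x'\<bar> / 2) + 6"
    using floor_diff_le[of "scale n * x" "scale n * x'"] by (simp add: abs_scale)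
qed

lemma scaled_flat_dist_ge_max:
  "max \<bar>x - x'\<bar> \<bar>y - y'\<bar> - 3 / scale n \<le> 2 * scaled_flat_dist n x y x' y'"
  unfolding scaled_flat_dist_def times_divide_eq_right
proof (rule divide_scale_ge)
  have "scale n * max \<bar>x - x'\<bar> \<bar>y - y'\<bar> = max (scale n * \<bar>x - x'\<bar>) (scale n * \<bar>y - y'\<bar>)"
    by (simp add: max_mult_distrib_left)
  then show "scale n * max \<bar>x - x'\<bar> \<bar>y - y'\<bar> - 3
      \<le> 2 * flat_dist \<lfloor>scale n * x\<rfloor> \<lfloor>scale n * y\<rfloor> \<lfloor>scale n * x'\<rfloor> \<lfloor>scale n * y'\<rfloor>"
    using flat_dist_ge_max[of "\<lfloor>scale n * x\<rfloor>" "\<lfloor>scale n * x'\<rfloor>" "\<lfloor>scale n * y\<rfloor>" "\<lfloor>scale n * y'\<rfloor>"]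
      floor_diff_ge[of "scale n * x" "scale n * x'"] floor_diff_ge[of "scale n * y" "scale n * y'"]
    unfolding abs_scale by (simp add: max_def split: if_splits)
qed

text \<open>Rounding four absolute values costs at most 2 in the minimum and 2 in the half sum,
  which raises the error from 4 to 8.\<close>

lemma opposite_estimate:
  fixes a b c d a' b' c' d' D :: real
  assumes "min (a + d) (b + c) + (a + b + c + d) / 2 - 4 \<le> D"
    "a' - 1 \<le> a" "b' - 1 \<le> b" "c' - 1 \<le> c" "d' - 1 \<le> d"
  shows "min (a' + d') (b' + c') + (a' + b' + c' + d') / 2 - 8 \<le> D"
  using assms unfolding min_def by argo

lemma scaled_flat_dist_ge_opposite:
  assumes "x * x' \<le> 0" "y * y' \<le> 0"
  shows "min (\<bar>x\<bar> + \<bar>y'\<bar>) (\<bar>y\<bar> + \<bar>x'\<bar>) + (\<bar>x\<bar> + \<bar>y\<bar> + \<bar>x'\<bar> + \<bar>y'\<bar>) / 2 - 8 / scale n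
    \<le> 2 * scaled_flat_dist n x y x' y'"
  unfolding scaled_flat_dist_def times_divide_eq_right
proof (rule divide_scale_ge)
  have np: "(scale n * x) * (scale n * x') \<le> 0" "(scale n * y) * (scale n * y') \<le> 0"
    using mult_nonneg_nonpos[OF _ assms(1), of "scale n * scale n"]
      mult_nonneg_nonpos[OF _ assms(2), of "scale n * scale n"]
    by (simp_all add: mult_ac less_imp_le)
  have "scale n * (min (\<bar>x\<bar> + \<bar>y'\<bar>) (\<bar>y\<bar> + \<bar>x'\<bar>) + (\<bar>x\<bar> + \<bar>y\<bar> + \<bar>x'\<bar> + \<bar>y'\<bar>) / 2) =
    min (scale n * \<bar>x\<bar> + scale n * \<bar>y'\<bar>) (scale n * \<bar>y\<bar> + scale n * \<bar>x'\<bar>)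
      + (scale n * \<bar>x\<bar> + scale n * \<bar>y\<bar> + scale n * \<bar>x'\<bar> + scale n * \<bar>y'\<bar>) / 2"
    by (simp add: min_mult_distrib_left distrib_left add_divide_distrib)
  then show "scale n * (min (\<bar>x\<bar> + \<bar>y'\<bar>) (\<bar>y\<bar> + \<bar>x'\<bar>) + (\<bar>x\<bar> + \<bar>y\<bar> + \<bar>x'\<bar> + \<bar>y'\<bar>) / 2) - 8
      \<le> 2 * flat_dist \<lfloor>scale n * x\<rfloor> \<lfloor>scale n * y\<rfloor> \<lfloor>scale n * x'\<rfloor> \<lfloor>scale n * y'\<rfloor>"
    using opposite_estimate[OF flat_dist_ge_opposite[OF floor_mult_nonpos[OF np(1)] floor_mult_nonpos[OF np(2)]]
        abs_floor_ge abs_floor_ge abs_floor_ge abs_floor_ge]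
    unfolding abs_scale by simp
qed

locale cone_ultrafilter =
  fixes \<omega> :: "nat filter"
  assumes nonprincipal: "nonprincipal_ultrafilter \<omega>" and le_sequentially: "\<omega> \<le> sequentially"
begin

abbreviation cone where "cone \<equiv> asymptotic_cone FF gens \<omega> scale"
abbreviation cone_dist where "cone_dist \<equiv> asymptotic_cone_dist FF gens \<omega> scale"

lemma not_bot: "\<omega> \<noteq> bot"
  using nonprincipal by (simp add: nonprincipal_ultrafilter_def)

sublocale cone: Metric_space cone cone_dist
  by (rule Metric_space_asymptotic_cone[OF group_FF finite_generating_set_gens nonprincipal scaling_sequence_scale])

abbreviation cone_seqs where
  "cone_seqs \<equiv> ultralimit_seqs (\<lambda>_. carrier FF) (\<lambda>n g h. word_dist FF gens g h / scale n) (\<lambda>_. \<one>\<^bsub>FF\<^esub>)"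

abbreviation cone_rel where
  "cone_rel \<equiv> ultralimit_rel \<omega> (\<lambda>_. carrier FF) (\<lambda>n g h. word_dist FF gens g h / scale n) (\<lambda>_. \<one>\<^bsub>FF\<^esub>)"

lemma flat_seq_mem: "flat_seq x y \<in> cone_seqs"
proof -
  \<comment> \<open>The base point of the cone is the origin of the flat, so the bound inside the
    flat also shows that the sequence defines a point of the cone.\<close>
  have one: "\<one>\<^bsub>FF\<^esub> = flat_seq 0 0 n" for n
    by (simp add: flat_seq_def arm_def DirProd_def F2_simps)
  have "scaled_flat_dist n 0 0 x y \<le> \<bar>x\<bar> + \<bar>y\<bar> + 2" for n
  proof -
    have "2 / scale n \<le> 2" by (simp add: scale_def pos_divide_le_eq)
    then show ?thesis using scaled_flat_dist_le_sum[of n 0 0 x y] by simp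
  qed
  moreover have "flat_seq x y n \<in> carrier FF" for n
    unfolding flat_seq_def by (rule arm_FF)
  ultimately show ?thesis
    unfolding ultralimit_seqs_def scaled_flat_dist_word_dist by (auto simp flip: one)
qed

definition flat :: "real \<Rightarrow> real \<Rightarrow> (nat \<Rightarrow> (nat \<times> bool) list \<times> (nat \<times> bool) list) set"
  where "flat x y = cone_rel `` {flat_seq x y}"

lemma flat_mem: "flat x y \<in> cone"
  unfolding flat_def asymptotic_cone_def ultralimit_def by (rule quotientI[OF flat_seq_mem])

text \<open>Together with \<open>one_FF\<close> these discharge the metric hypotheses of the
  ultralimit lemmas.\<close>

lemma
  shows scaled_word_dist_nonneg: "0 \<le> word_dist FF gens g h / scale n"
    and scaled_word_dist_refl: "g \<in> carrier FF \<Longrightarrow> word_dist FF gens g g / scale n = 0"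
    and scaled_word_dist_commute: "\<lbrakk>g \<in> carrier FF; h \<in> carrier FF\<rbrakk> \<Longrightarrow>
      word_dist FF gens g h / scale n = word_dist FF gens h g / scale n"
    and scaled_word_dist_triangle: "\<lbrakk>g \<in> carrier FF; h \<in> carrier FF; k \<in> carrier FF\<rbrakk> \<Longrightarrow>
      word_dist FF gens g k / scale n \<le> word_dist FF gens g h / scale n + word_dist FF gens h k / scale n"
proof -
  note W = group_FF finite_generating_set_gens
  show "0 \<le> word_dist FF gens g h / scale n" by (simp add: word_dist_def)
  show "word_dist FF gens g g / scale n = 0" if "g \<in> carrier FF"
    using group.word_dist_eq_0_iff[OF W that that] by auto
  show "word_dist FF gens g h / scale n = word_dist FF gens h g / scale n"
    if "g \<in> carrier FF" "h \<in> carrier FF"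
    by (simp only: group.word_dist_commute[OF W that])
  show "word_dist FF gens g k / scale n \<le> word_dist FF gens g h / scale n + word_dist FF gens h k / scale n"
    if "g \<in> carrier FF" "h \<in> carrier FF" "k \<in> carrier FF"
    unfolding add_divide_distrib[symmetric]
    by (intro divide_right_mono group.word_dist_triangle[OF W that] scale_pos)
qed

lemma one_FF: "\<one>\<^bsub>FF\<^esub> \<in> carrier FF"
  by (rule monoid.one_closed[OF group.is_monoid[OF group_FF]])

lemma flat_self: "flat_seq x y \<in> flat x y"
proof -
  have "equiv cone_seqs cone_rel"
    by (rule ultralimit_rel_equiv[OF nonprincipal])
       (rule one_FF scaled_word_dist_nonneg scaled_word_dist_refl scaled_word_dist_commute
         scaled_word_dist_triangle; assumption?)+
  then show ?thesis unfolding flat_def by (rule equiv_class_self[OF _ flat_seq_mem])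
qed

text \<open>Turns an estimate of rescaled distances that holds for every \<open>n\<close> into one
  in the cone, where the error \<open>K / scale n\<close> disappears.\<close>

lemma flat_dist_tendsto:
  "((\<lambda>n. scaled_flat_dist n x y x' y') \<longlongrightarrow> cone_dist (flat x y) (flat x' y')) \<omega>"
  unfolding scaled_flat_dist_word_dist asymptotic_cone_dist_def
  by (rule ultralimit_dist_tendsto[OF nonprincipal _ _ _ _ _
        flat_mem[unfolded asymptotic_cone_def] flat_mem[unfolded asymptotic_cone_def] flat_self flat_self])
     (rule one_FF scaled_word_dist_nonneg scaled_word_dist_refl scaled_word_dist_commute
       scaled_word_dist_triangle; assumption?)+

lemma error_tendsto: "((\<lambda>n. c + K / scale n) \<longlongrightarrow> c) \<omega>"
proof -
  have "(\<lambda>n. K / scale n) \<longlonglongrightarrow> 0"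
    using scaling_sequence_scale unfolding scaling_sequence_def
    by (intro real_tendsto_divide_at_top[OF tendsto_const]) simp
  then have "((\<lambda>n. K / scale n) \<longlongrightarrow> 0) \<omega>" by (rule tendsto_mono[OF le_sequentially])
  from tendsto_add[OF tendsto_const this] show ?thesis by simp
qed

lemma flat_le_sum: "cone_dist (flat x y) (flat x' y') \<le> \<bar>x - x'\<bar> + \<bar>y - y'\<bar>"
  by (rule tendsto_le[OF not_bot error_tendsto[of _ 2] flat_dist_tendsto])
     (intro always_eventually allI scaled_flat_dist_le_sum)

lemma flat_le_diamond:
  assumes "0 \<le> x * x'" "0 \<le> y * y'" "\<bar>x\<bar> + \<bar>y\<bar> = \<bar>x'\<bar> + \<bar>y'\<bar>"
  shows "cone_dist (flat x y) (flat x' y') \<le> \<bar>x - x'\<bar> / 2"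
  by (rule tendsto_le[OF not_bot error_tendsto[of _ 6] flat_dist_tendsto])
     (intro always_eventually allI scaled_flat_dist_le_diamond assms)

lemma flat_ge:
  assumes "\<And>n. c - K / scale n \<le> 2 * scaled_flat_dist n x y x' y'"
  shows "c \<le> 2 * cone_dist (flat x y) (flat x' y')"
  using assms
  by (intro tendsto_le[OF not_bot tendsto_mult[OF tendsto_const flat_dist_tendsto] error_tendsto[of c "- K"]])
     (auto intro: always_eventually)

lemmas flat_ge_max = flat_ge[OF scaled_flat_dist_ge_max]

lemmas flat_ge_opposite = flat_ge[OF scaled_flat_dist_ge_opposite]

end

section \<open>The circle\<close>

text \<open>Describes the circle as the interval of arguments with its ends glued: the distance is
  the shorter of the two ways around.\<close>

lemma abs_Arg_divide:
  assumes "z \<noteq> 0" "w \<noteq> 0"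
  shows "\<bar>Arg (z / w)\<bar> = min \<bar>Arg z - Arg w\<bar> (2 * pi - \<bar>Arg z - Arg w\<bar>)"
proof -
  \<comment> \<open>On the negative real axis the argument of the inverse stays at pi instead of
    changing its sign.\<close>
  have w: "Arg (inverse w) = - Arg w \<or> Arg (inverse w) = pi \<and> Arg w = pi"
    using Arg_inverse[of w] Arg_eq_0_pi[of w] by (auto split: if_splits)
  have "inverse w \<noteq> 0" using assms by simp
  from Arg_times'[OF assms(1) this] w show ?thesis
    using Arg_bounded[of z] Arg_bounded[of w] Arg_bounded[of "inverse w"]
    unfolding divide_inverse Let_def by (auto simp: min_def split: if_splits)
qed

text \<open>The curve \<open>(diamond_x t, diamond_y t)\<close> for \<open>- 2 \<le> t \<le> 2\<close> runs once around
  \<open>\<bar>x\<bar> + \<bar>y\<bar> = 1\<close>.\<close>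

definition diamond_x :: "real \<Rightarrow> real"
  where "diamond_x t = 1 - \<bar>t\<bar>"

definition diamond_y :: "real \<Rightarrow> real"
  where "diamond_y t = \<bar>t + 1\<bar> - \<bar>t - 1\<bar> - t"

lemma diamond_cases:
  assumes "- 2 \<le> t" "t \<le> 2"
  obtains (1) "- 2 \<le> t" "t \<le> - 1" "diamond_x t = 1 + t" "diamond_y t = - 2 - t"
  | (2) "- 1 \<le> t" "t \<le> 0" "diamond_x t = 1 + t" "diamond_y t = t"
  | (3) "0 \<le> t" "t \<le> 1" "diamond_x t = 1 - t" "diamond_y t = t"
  | (4) "1 \<le> t" "t \<le> 2" "diamond_x t = 1 - t" "diamond_y t = 2 - t"
proof -
  consider "t \<le> - 1" | "- 1 \<le> t" "t \<le> 0" | "0 \<le> t" "t \<le> 1" | "1 \<le> t" by linarith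
  then show thesis
    by cases (use assms that in \<open>simp_all add: diamond_x_def diamond_y_def\<close>)
qed

lemma diamond_abs_sum:
  assumes "- 2 \<le> t" "t \<le> 2"
  shows "\<bar>diamond_x t\<bar> + \<bar>diamond_y t\<bar> = 1"
  using assms by (cases rule: diamond_cases) auto

text \<open>\<open>D\<close> will be twice the distance in the cone. On the same side or on adjacent
  sides one coordinate difference equals the length of one of the two arcs. On opposite sides the
  two terms of the minimum, each plus 1, are the two arc lengths; this 1 is half the sum of all four
  absolute coordinates.\<close>

lemma diamond_lower_bound:
  assumes t: "- 2 \<le> t" "t \<le> 2" and u: "- 2 \<le> u" "u \<le> 2"
    and max: "max \<bar>diamond_x t - diamond_x u\<bar> \<bar>diamond_y t - diamond_y u\<bar> \<le> D"
    and opp: "\<lbrakk>diamond_x t * diamond_x u \<le> 0; diamond_y t * diamond_y u \<le> 0\<rbrakk> \<Longrightarrow>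
      min (\<bar>diamond_x t\<bar> + \<bar>diamond_y u\<bar>) (\<bar>diamond_y t\<bar> + \<bar>diamond_x u\<bar>) + 1 \<le> D"
  shows "min \<bar>t - u\<bar> (4 - \<bar>t - u\<bar>) \<le> D"
proof -
  have max': "\<bar>diamond_x t - diamond_x u\<bar> \<le> D" "\<bar>diamond_y t - diamond_y u\<bar> \<le> D"
    using max by auto
  have opp': "min (\<bar>diamond_x t\<bar> + \<bar>diamond_y u\<bar>) (\<bar>diamond_y t\<bar> + \<bar>diamond_x u\<bar>) + 1 \<le> D"
    if "diamond_x t \<le> 0 \<and> 0 \<le> diamond_x u \<or> 0 \<le> diamond_x t \<and> diamond_x u \<le> 0"
      "diamond_y t \<le> 0 \<and> 0 \<le> diamond_y u \<or> 0 \<le> diamond_y t \<and> diamond_y u \<le> 0"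
    using that by (intro opp) (auto simp: mult_le_0_iff)
  show ?thesis
    using t
  proof (cases rule: diamond_cases)
    case t: 1
    from u show ?thesis
      by (cases rule: diamond_cases) (use t max' opp' in argo)+
  next
    case t: 2
    from u show ?thesis
      by (cases rule: diamond_cases) (use t max' opp' in argo)+
  next
    case t: 3
    from u show ?thesis
      by (cases rule: diamond_cases) (use t max' opp' in argo)+
  next
    case t: 4
    from u show ?thesis
      by (cases rule: diamond_cases) (use t max' opp' in argo)+
  qed
qed

lemma lipschitz_glue:
  fixes D :: "real \<Rightarrow> real \<Rightarrow> real"
  assumes tri: "\<And>t u v. D t v \<le> D t u + D u v"
    and ab: "\<And>t u. a \<le> t \<Longrightarrow> t \<le> u \<Longrightarrow> u \<le> b \<Longrightarrow> D t u \<le> c * (u - t)"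
    and bc: "\<And>t u. b \<le> t \<Longrightarrow> t \<le> u \<Longrightarrow> u \<le> d \<Longrightarrow> D t u \<le> c * (u - t)"
    and tu: "a \<le> t" "t \<le> u" "u \<le> d"
  shows "D t u \<le> c * (u - t)"
proof -
  consider "u \<le> b" | "b \<le> t" | "t \<le> b" "b \<le> u" by linarith
  then show ?thesis
  proof cases
    case 3
    have "D t u \<le> c * (b - t) + c * (u - b)"
      using tri[of t u b] ab[of t b] bc[of b u] tu 3 by linarith
    then show ?thesis by (simp add: algebra_simps)
  qed (use ab bc tu in auto)
qed

section \<open>The square as an isometrically embedded circle\<close>

context cone_ultrafilter
begin

definition diamond :: "real \<Rightarrow> (nat \<Rightarrow> (nat \<times> bool) list \<times> (nat \<times> bool) list) set"
  where "diamond t = flat (diamond_x t) (diamond_y t)"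

lemma diamond_mem: "diamond t \<in> cone"
  by (simp add: diamond_def flat_mem)

text \<open>Between consecutive corners no coordinate changes sign, so the bound for a single side
  applies. The speed 1/2 reflects that a fast generator moves each coordinate by 2.\<close>

lemma diamond_side:
  assumes "k \<in> {- 2, - 1, 0, 1}" "k \<le> t" "t \<le> u" "u \<le> k + 1"
  shows "cone_dist (diamond t) (diamond u) \<le> 1 / 2 * (u - t)"
proof -
  have sides: "0 \<le> diamond_x t * diamond_x u" "0 \<le> diamond_y t * diamond_y u"
    "\<bar>diamond_x t - diamond_x u\<bar> = u - t"
    using assms by (auto simp: diamond_x_def diamond_y_def zero_le_mult_iff abs_if)
  have "- 2 \<le> t" "t \<le> 2" "- 2 \<le> u" "u \<le> 2" using assms by auto
  then have "\<bar>diamond_x t\<bar> + \<bar>diamond_y t\<bar> = \<bar>diamond_x u\<bar> + \<bar>diamond_y u\<bar>"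
    by (simp add: diamond_abs_sum)
  from flat_le_diamond[OF sides(1,2) this] sides(3) show ?thesis by (simp add: diamond_def)
qed

lemma diamond_arc:
  assumes "- 2 \<le> t" "t \<le> u" "u \<le> 2"
  shows "cone_dist (diamond t) (diamond u) \<le> 1 / 2 * (u - t)"
proof -
  note glue = lipschitz_glue[where D = "\<lambda>t u. cone_dist (diamond t) (diamond u)" and c = "1 / 2",
      OF cone.triangle[OF diamond_mem diamond_mem diamond_mem]]
  have 1: "cone_dist (diamond t) (diamond u) \<le> 1 / 2 * (u - t)" if "- 2 \<le> t" "t \<le> u" "u \<le> 0" for t u
    by (rule glue[where a = "- 2" and b = "- 1" and d = 0])
       (use that diamond_side[of "- 2"] diamond_side[of "- 1"] in auto)
  have 2: "cone_dist (diamond t) (diamond u) \<le> 1 / 2 * (u - t)" if "0 \<le> t" "t \<le> u" "u \<le> 2" for t u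
    by (rule glue[where a = 0 and b = 1 and d = 2])
       (use that diamond_side[of 0] diamond_side[of 1] in auto)
  show ?thesis by (rule glue[OF 1 2 assms])
qed

lemma diamond_isometric:
  assumes "- 2 \<le> t" "t \<le> 2" "- 2 \<le> u" "u \<le> 2"
  shows "2 * cone_dist (diamond t) (diamond u) = min \<bar>t - u\<bar> (4 - \<bar>t - u\<bar>)"
proof (rule antisym)
  \<comment> \<open>The curve closes up, so a second upper bound comes from the complementary arc
    through the parameter 2.\<close>
  have wrap: "diamond (- 2) = diamond 2" by (simp add: diamond_def diamond_x_def diamond_y_def)
  have "2 * cone_dist (diamond t) (diamond u) \<le> u - t \<and>
      2 * cone_dist (diamond t) (diamond u) \<le> 4 - (u - t)"
    if "- 2 \<le> t" "t \<le> u" "u \<le> 2" for t u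
    using diamond_arc[of t u] diamond_arc[of "- 2" t] diamond_arc[of u 2] that
      cone.triangle[OF diamond_mem diamond_mem diamond_mem, of t u 2]
      cone.commute[of "diamond t" "diamond 2"] cone.commute[of "diamond u" "diamond 2"]
    unfolding wrap by auto
  from this[of t u] this[of u t] show "2 * cone_dist (diamond t) (diamond u) \<le> min \<bar>t - u\<bar> (4 - \<bar>t - u\<bar>)"
    using assms cone.commute[of "diamond t" "diamond u"] by (cases "t \<le> u") auto
  show "min \<bar>t - u\<bar> (4 - \<bar>t - u\<bar>) \<le> 2 * cone_dist (diamond t) (diamond u)"
    unfolding diamond_def
  proof (rule diamond_lower_bound[OF assms flat_ge_max])
    assume "diamond_x t * diamond_x u \<le> 0" "diamond_y t * diamond_y u \<le> 0"
    from flat_ge_opposite[OF this] diamond_abs_sum[OF assms(1,2)] diamond_abs_sum[OF assms(3,4)]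
    show "min (\<bar>diamond_x t\<bar> + \<bar>diamond_y u\<bar>) (\<bar>diamond_y t\<bar> + \<bar>diamond_x u\<bar>) + 1
        \<le> 2 * cone_dist (flat (diamond_x t) (diamond_y t)) (flat (diamond_x u) (diamond_y u))"
      by (simp add: add.assoc)
  qed
qed

text \<open>Stretches the argument to the parameter interval of the square. That interval has length
  4 and is traversed at speed 1/2, so the circle has circumference 2 and radius
  \<open>1 / pi\<close>.\<close>

definition circle_param :: "complex \<Rightarrow> real"
  where "circle_param z = 2 * Arg z / pi"

lemma circle_param_bounds: "- 2 \<le> circle_param z" "circle_param z \<le> 2"
  using Arg_bounded[of z] by (simp_all add: circle_param_def pos_le_divide_eq pos_divide_le_eq)

definition circle_map :: "complex \<Rightarrow> (nat \<Rightarrow> (nat \<times> bool) list \<times> (nat \<times> bool) list) set"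
  where "circle_map z = diamond (circle_param z)"

lemma circle_map_isometric:
  assumes "z \<noteq> 0" "w \<noteq> 0"
  shows "cone_dist (circle_map z) (circle_map w) = arc_dist (1 / pi) z w"
proof -
  have "circle_param z - circle_param w = 2 / pi * (Arg z - Arg w)"
    by (simp add: circle_param_def diff_divide_distrib right_diff_distrib)
  then have "\<bar>circle_param z - circle_param w\<bar> = 2 / pi * \<bar>Arg z - Arg w\<bar>"
    by (simp only: abs_mult) simp
  moreover have "4 - 2 / pi * d = 2 / pi * (2 * pi - d)" for d
    by (simp add: right_diff_distrib)
  ultimately have "min \<bar>circle_param z - circle_param w\<bar> (4 - \<bar>circle_param z - circle_param w\<bar>)
      = 2 / pi * min \<bar>Arg z - Arg w\<bar> (2 * pi - \<bar>Arg z - Arg w\<bar>)"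
    by (simp only: min_mult_distrib_left) simp
  then have "2 * cone_dist (circle_map z) (circle_map w) = 2 / pi * \<bar>Arg (z / w)\<bar>"
    unfolding circle_map_def abs_Arg_divide[OF assms]
    using diamond_isometric[OF circle_param_bounds circle_param_bounds, of z w] by argo
  then show ?thesis by (simp add: arc_dist_def)
qed

abbreviation circle where "circle \<equiv> sphere (0 :: complex) (1 / pi)"

sublocale circle: Metric_space circle "arc_dist (1 / pi)"
  by (rule Metric_space_circle) simp

lemma circle_nonzero: "z \<in> circle \<Longrightarrow> z \<noteq> 0"
  by auto

lemma circle_map_embedding:
  "isometric_embedding circle (arc_dist (1 / pi)) cone cone_dist circle_map"
  unfolding isometric_embedding_def
  using circle_map_isometric circle_nonzero by (auto simp: circle_map_def diamond_mem)

section \<open>Contracting the circle inside the flat\<close>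

lemma continuous_flat:
  "continuous_map euclidean cone.mtopology (\<lambda>p. flat (fst p) (snd p))"
proof -
  have "continuous_map Met_TC.mtopology cone.mtopology (\<lambda>p :: real \<times> real. flat (fst p) (snd p))"
    unfolding Met_TC.metric_continuous_map[OF cone.Metric_space_axioms]
  proof (intro conjI ballI allI impI)
    show "range (\<lambda>p. flat (fst p) (snd p)) \<subseteq> cone" using flat_mem by auto
    fix a :: "real \<times> real" and e :: real assume e: "0 < e"
    show "\<exists>d>0. \<forall>x. x \<in> UNIV \<and> dist a x < d \<longrightarrow> cone_dist (flat (fst a) (snd a)) (flat (fst x) (snd x)) < e"
    proof (intro exI[of _ "e / 2"] conjI allI impI)
      fix x assume "x \<in> UNIV \<and> dist a x < e / 2"
      then show "cone_dist (flat (fst a) (snd a)) (flat (fst x) (snd x)) < e"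
        using flat_le_sum[of "fst a" "snd a" "fst x" "snd x"] dist_fst_le[of a x] dist_snd_le[of a x]
        by (simp add: dist_real_def)
    qed (use e in simp)
  qed
  then show ?thesis by simp
qed

text \<open>\<open>circle_param\<close> jumps on the negative real axis, so continuity is not
  inherited from it. Instead \<open>flat_ge_max\<close> bounds the coordinate differences by twice
  the cone distance, which is the arc distance because the circle is embedded isometrically.\<close>

lemma continuous_diamond_coordinates:
  "continuous_map circle.mtopology euclidean (\<lambda>z. diamond_x (circle_param z))"
  "continuous_map circle.mtopology euclidean (\<lambda>z. diamond_y (circle_param z))"
proof -
  have lip: "\<bar>diamond_x (circle_param z) - diamond_x (circle_param w)\<bar> \<le> 2 * arc_dist (1 / pi) z w"
      "\<bar>diamond_y (circle_param z) - diamond_y (circle_param w)\<bar> \<le> 2 * arc_dist (1 / pi) z w"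
    if "z \<in> circle" "w \<in> circle" for z w
    using flat_ge_max[of "diamond_x (circle_param z)" "diamond_x (circle_param w)"
        "diamond_y (circle_param z)" "diamond_y (circle_param w)"]
      circle_map_isometric[of z w] circle_nonzero that
    by (simp_all add: circle_map_def diamond_def)
  have cont: "continuous_map circle.mtopology euclidean h"
    if "\<And>z w. z \<in> circle \<Longrightarrow> w \<in> circle \<Longrightarrow> \<bar>h z - h w\<bar> \<le> 2 * arc_dist (1 / pi) z w" for h :: "complex \<Rightarrow> real"
  proof -
    have "continuous_map circle.mtopology Met_TC.mtopology h"
      unfolding circle.metric_continuous_map[OF Met_TC.Metric_space_axioms]
    proof (intro conjI ballI allI impI)
      fix a and e :: real assume a: "a \<in> circle" and e: "0 < e"
      show "\<exists>d>0. \<forall>x. x \<in> circle \<and> arc_dist (1 / pi) a x < d \<longrightarrow> dist (h a) (h x) < e"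
      proof (intro exI[of _ "e / 2"] conjI allI impI)
        fix x assume "x \<in> circle \<and> arc_dist (1 / pi) a x < e / 2"
        then show "dist (h a) (h x) < e" using that[OF a, of x] by (simp add: dist_real_def)
      qed (use e in simp)
    qed simp
    then show ?thesis by simp
  qed
  show "continuous_map circle.mtopology euclidean (\<lambda>z. diamond_x (circle_param z))"
    "continuous_map circle.mtopology euclidean (\<lambda>z. diamond_y (circle_param z))"
    by (rule cont; erule (1) lip)+
qed

lemma null_homotopic_circle_map: "null_homotopic circle.mtopology cone.mtopology circle_map"
proof -
  let ?P = "prod_topology (top_of_set {0..1 :: real}) circle.mtopology"
  \<comment> \<open>The contraction takes place in the coordinate plane, where multiplication is
    continuous; \<open>continuous_flat\<close> then carries it into the cone.\<close>
  define h :: "real \<times> complex \<Rightarrow> real \<times> real" where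
    "h = (\<lambda>p. ((1 - fst p) * diamond_x (circle_param (snd p)), (1 - fst p) * diamond_y (circle_param (snd p))))"
  have t: "continuous_map ?P euclidean (\<lambda>p. 1 - fst p)"
    by (intro continuous_map_diff continuous_map_into_fulltopology[OF continuous_map_fst]) auto
  have "continuous_map ?P (prod_topology euclidean euclidean) h"
    unfolding h_def
    by (intro continuous_map_pairedI continuous_map_real_mult t
        continuous_map_compose[OF continuous_map_snd continuous_diamond_coordinates(1), unfolded o_def]
        continuous_map_compose[OF continuous_map_snd continuous_diamond_coordinates(2), unfolded o_def])
  then have "continuous_map ?P euclidean h" by simp
  from continuous_map_compose[OF this continuous_flat]
  have "continuous_map ?P cone.mtopology (\<lambda>p. flat (fst (h p)) (snd (h p)))" by (simp add: o_def)
  then have "homotopic_with (\<lambda>_. True) circle.mtopology cone.mtopology circle_map (\<lambda>_. flat 0 0)"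
    unfolding homotopic_with_def
    by (intro exI[of _ "\<lambda>p. flat (fst (h p)) (snd (h p))"]) (simp add: h_def circle_map_def diamond_def)
  then show ?thesis
    unfolding null_homotopic_def by (intro bexI[of _ "flat 0 0"]) (simp_all add: flat_mem)
qed

end

theorem corollary1p2:
  shows "\<exists>A \<omega> s. finite_generating_set (F2 \<times>\<times> F2) A \<and>
           nonprincipal_ultrafilter \<omega> \<and> scaling_sequence s \<and>
           (\<exists>r>0. \<exists>f :: complex \<Rightarrow> (nat \<Rightarrow> (nat \<times> bool) list \<times> (nat \<times> bool) list) set.
              isometric_embedding
                (sphere 0 r) (arc_dist r)
                (asymptotic_cone (F2 \<times>\<times> F2) A \<omega> s) (asymptotic_cone_dist (F2 \<times>\<times> F2) A \<omega> s) f \<and>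
              null_homotopic
                (Metric_space.mtopology (sphere 0 r) (arc_dist r))
                (Metric_space.mtopology
                  (asymptotic_cone (F2 \<times>\<times> F2) A \<omega> s) (asymptotic_cone_dist (F2 \<times>\<times> F2) A \<omega> s)) f)"
proof -
  obtain \<omega> where \<omega>: "nonprincipal_ultrafilter \<omega>" "\<omega> \<le> sequentially"
    by (rule nonprincipal_ultrafilter_ex)
  interpret cone_ultrafilter \<omega> by unfold_locales (fact \<omega>)+
  have "0 < 1 / pi" by simp
  with finite_generating_set_gens \<omega>(1) scaling_sequence_scale circle_map_embedding null_homotopic_circle_map
  show ?thesis by blast
qed

end
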